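(* Let $\mathbf P$ be an irreducible $s\times s$ stochastic matrix with stationary row vector $\boldsymbol\pi$, let $\widehat{\mathbf P}(n)$ be its maximum likelihood estimator, and let $\mathbf W=(W_{ij})$ be the Gaussian matrix of the context. Put $\mathbf R_\pi=(\mathbf I_s-\mathbf P+\mathbf 1_s\boldsymbol\pi)^{-1}$. (a) Let $\mathbf g=(g(1),\ldots,g(s))^\top\in\mathbb R^s$ be fixed, $\mu_g=\boldsymbol\pi\mathbf g$, $\mathbf g_0=\mathbf g-\mu_g\mathbf 1_s$, $\mathbf D_{\mathbf g_0}=\operatorname{diag}(g_0(1),\ldots,g_0(s))$, $\mathbf h_g=\mathbf R_\pi\mathbf g_0$, and define the additive-functional variance $$\phi_g(\mathbf P)=2\boldsymbol\pi\mathbf D_{\mathbf g_0}\mathbf h_g-\boldsymbol\pi\mathbf D_{\mathbf g_0}\mathbf g_0.$$ Then $$\sqrt n\{\phi_g(\widehat{\mathbf P}(n))-\phi_g(\mathbf P)\}\xrightarrow{d}\phi'_{g,\mathbf P}(\mathbf W),$$ where, for $\mathbf H\in\mathcal T_{\mathbf P}$, $$\phi'_{g,\mathbf P}(\mathbf H)=\boldsymbol\pi\mathbf H\mathbf R_\pi\left(2\mathbf D_{\mathbf g_0}\mathbf h_g-\mathbf D_{\mathbf g_0}\mathbf g_0\right)+2\boldsymbol\pi\mathbf D_{\mathbf g_0}\mathbf R_\pi\mathbf H\mathbf h_g.$$ (b) The Kemeny constant $K(\mathbf P)=\operatorname{tr}\{(\mathbf I_s-\mathbf P+\mathbf 1_s\boldsymbol\pi)^{-1}\}$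 satisfies $$\sqrt n\{K(\widehat{\mathbf P}(n))-K(\mathbf P)\}\xrightarrow{d}\operatorname{tr}(\mathbf R_\pi\mathbf W\mathbf R_\pi).$$ (c) Assume moreover that all transition probabilities $p_{ij}$ are positive. The entropy rate $\mathcal H(\mathbf P)=-\sum_{i=1}^s\pi_i\sum_{j=1}^sp_{ij}\log p_{ij}$ satisfies $$\sqrt n\{\mathcal H(\widehat{\mathbf P}(n))-\mathcal H(\mathbf P)\}\xrightarrow{d}\boldsymbol\pi\mathbf W\mathbf R_\pi\mathbf r_{\mathbf P}-\sum_{i=1}^s\pi_i\sum_{j=1}^sW_{ij}\log p_{ij},$$ where $\mathbf r_{\mathbf P}\in\mathbb R^s$ has entries $(\mathbf r_{\mathbf P})_i=-\sum_{j=1}^sp_{ij}\log p_{ij}$.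
   Context: $(X_m)_{m\ge0}$ is a time-homogeneous Markov chain on $\{1,\ldots,s\}$ with irreducible transition matrix $\mathbf P=(p_{ij})$ and stationary row vector $\boldsymbol\pi=(\pi_1,\ldots,\pi_s)$, observed along a single trajectory $X_0,\ldots,X_n$. $N_{ij}(n)$ is the number of transitions from $i$ to $j$ up to time $n$, $N_i(n)=\sum_jN_{ij}(n)$, and $\widehat{\mathbf P}(n)$ has entries $N_{ij}(n)/N_i(n)$ (and $0$ if $N_i(n)=0$). Limits are as $n\to\infty$; $\xrightarrow{d}$ is convergence in distribution. $\mathbf 1_s=(1,\ldots,1)^\top$. The quantities $\phi_g,K,\mathcal H$ are functionals of an irreducible stochastic matrix, with $\boldsymbol\pi$, $\mu_g$, $\mathbf g_0$, $\mathbf h_g$, $\mathbf R_\pi$ all depending on that matrix; plug-in values are obtained by replacing $\mathbf P$ by $\widehat{\mathbf P}(n)$ throughout (including in $\boldsymbol\pi$), and may be defined arbitrarily when $\widehat{\mathbf P}(n)$ is not an irreducible stochastic matrix. $\mathbf W=(W_{ij})$ is the centered Gaussian random $s\times s$ matrix with $\operatorname{Cov}(W_{ij},W_{kl})=\delta_{ik}\pi_i^{-1}p_{ij}(\delta_{jl}-p_{il})$. $\mathcal T_{\mathbf P}=\{\mathbf H\in\mathbb R^{s\times s}:\mathbf H\mathbf 1_s=\mathbf 0_s,\ h_{ij}=0\text{ whenever }p_{ij}=0\}$; $\mathbf W\in\mathcal T_{\mathbf P}$ almost surely. $\phi'_{g,\mathbf P}(\mathbf H)$ is the derivative of $\phi_g$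 at $\mathbf P$ in the direction $\mathbf H\in\mathcal T_{\mathbf P}$. *)

theory Defs
  imports "HOL-Probability.Probability"
begin

section \<open>Irreducible stochastic matrices\<close>

definition stochastic_matrix :: "real^'s^'s \<Rightarrow> bool" where
  "stochastic_matrix P \<longleftrightarrow> (\<forall>i j. 0 \<le> P $ i $ j) \<and> (\<forall>i. (\<Sum>j\<in>UNIV. P $ i $ j) = 1)"

text \<open>The operation \<open>*\<close> on \<open>real^'s^'s\<close> is entrywise, so \<open>^\<close> is not the matrix power.\<close>

definition matrix_power :: "real^'s^'s \<Rightarrow> nat \<Rightarrow> real^'s^'s" where
  "matrix_power P n = (((**) P) ^^ n) (mat 1)"

definition irreducible_stochastic :: "real^'s^'s \<Rightarrow> bool" where
  "irreducible_stochastic P \<longleftrightarrow>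
     stochastic_matrix P \<and> (\<forall>i j. \<exists>n>0. matrix_power P n $ i $ j > 0)"

definition is_stationary :: "real^'s^'s \<Rightarrow> real^'s \<Rightarrow> bool" where
  "is_stationary P \<pi> \<longleftrightarrow> (\<forall>i. 0 \<le> \<pi> $ i) \<and> (\<Sum>i\<in>UNIV. \<pi> $ i) = 1 \<and> \<pi> v* P = \<pi>"

text \<open>Meaningful for irreducible stochastic matrices, whose stationary vector is unique.\<close>

definition stationary :: "real^'s^'s \<Rightarrow> real^'s" where
  "stationary P = (THE \<pi>. is_stationary P \<pi>)"

text \<open>\<open>\<chi> i j. stationary P $ j\<close> is the rank-one matrix with all rows equal to the
  stationary vector.\<close>

definition R_stat :: "real^'s^'s \<Rightarrow> real^'s^'s" where
  "R_stat P = matrix_inv (mat 1 - P + (\<chi> i j. stationary P $ j))"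

definition diag_matrix :: "real^'s \<Rightarrow> real^'s^'s" where
  "diag_matrix v = (\<chi> i j. if i = j then v $ i else 0)"


section \<open>The functionals\<close>

definition mu_fun :: "real^'s \<Rightarrow> real^'s^'s \<Rightarrow> real" where
  "mu_fun g P = stationary P \<bullet> g"

definition g0_fun :: "real^'s \<Rightarrow> real^'s^'s \<Rightarrow> real^'s" where
  "g0_fun g P = g - mu_fun g P *\<^sub>R 1"

definition h_fun :: "real^'s \<Rightarrow> real^'s^'s \<Rightarrow> real^'s" where
  "h_fun g P = R_stat P *v g0_fun g P"

definition phi :: "real^'s \<Rightarrow> real^'s^'s \<Rightarrow> real" where
  "phi g P =
     2 * (stationary P \<bullet> (diag_matrix (g0_fun g P) *v h_fun g P))
     - stationary P \<bullet> (diag_matrix (g0_fun g P) *v g0_fun g P)"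

definition phi_deriv :: "real^'s \<Rightarrow> real^'s^'s \<Rightarrow> real^'s^'s \<Rightarrow> real" where
  "phi_deriv g P H =
     (stationary P v* (H ** R_stat P)) \<bullet>
       (2 *\<^sub>R (diag_matrix (g0_fun g P) *v h_fun g P) - diag_matrix (g0_fun g P) *v g0_fun g P)
     + 2 * ((stationary P v* (diag_matrix (g0_fun g P) ** R_stat P ** H)) \<bullet> h_fun g P)"

definition tangent_space :: "real^'s^'s \<Rightarrow> (real^'s^'s) set" where
  "tangent_space P = {H. H *v 1 = 0 \<and> (\<forall>i j. P $ i $ j = 0 \<longrightarrow> H $ i $ j = 0)}"

definition kemeny :: "real^'s^'s \<Rightarrow> real" where
  "kemeny P = trace (R_stat P)"

text \<open>Since \<open>ln 0 = 0\<close>, the usual convention \<open>0 log 0 = 0\<close> is in force.\<close>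

definition row_entropy :: "real^'s^'s \<Rightarrow> real^'s" where
  "row_entropy P = (\<chi> i. - (\<Sum>j\<in>UNIV. P $ i $ j * ln (P $ i $ j)))"

definition entropy_rate :: "real^'s^'s \<Rightarrow> real" where
  "entropy_rate P = - (\<Sum>i\<in>UNIV. stationary P $ i * (\<Sum>j\<in>UNIV. P $ i $ j * ln (P $ i $ j)))"


section \<open>The Markov chain and its empirical transition matrix\<close>

text \<open>The initial distribution is arbitrary.\<close>

definition markov_chain :: "'a measure \<Rightarrow> (nat \<Rightarrow> 'a \<Rightarrow> 's) \<Rightarrow> real^'s^'s \<Rightarrow> bool" where
  "markov_chain M X P \<longleftrightarrow>
     prob_space M \<and>
     (\<forall>m. X m \<in> M \<rightarrow>\<^sub>M count_space UNIV) \<and>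
     (\<forall>m (x :: nat \<Rightarrow> 's). \<P>(\<omega> in M. \<forall>k\<le>m. X k \<omega> = x k) > 0 \<longrightarrow>
        \<P>(\<omega> in M. X (Suc m) \<omega> = x (Suc m) \<bar> \<forall>k\<le>m. X k \<omega> = x k) = P $ x m $ x (Suc m))"

definition transition_count :: "(nat \<Rightarrow> 'a \<Rightarrow> 's) \<Rightarrow> nat \<Rightarrow> 'a \<Rightarrow> 's \<Rightarrow> 's \<Rightarrow> nat" where
  "transition_count X n \<omega> i j = card {m. m < n \<and> X m \<omega> = i \<and> X (Suc m) \<omega> = j}"

definition visit_count :: "(nat \<Rightarrow> 'a \<Rightarrow> 's::finite) \<Rightarrow> nat \<Rightarrow> 'a \<Rightarrow> 's \<Rightarrow> nat" where
  "visit_count X n \<omega> i = (\<Sum>j\<in>UNIV. transition_count X n \<omega> i j)"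

definition P_hat :: "(nat \<Rightarrow> 'a \<Rightarrow> 's::finite) \<Rightarrow> nat \<Rightarrow> 'a \<Rightarrow> real^'s^'s" where
  "P_hat X n \<omega> =
     (\<chi> i j. if visit_count X n \<omega> i = 0 then 0
            else real (transition_count X n \<omega> i j) / real (visit_count X n \<omega> i))"

text \<open>\<open>Z n\<close> is a version of \<open>f\<close> evaluated at \<open>P_hat X n\<close>: its values are unconstrained where
  the empirical matrix is not an irreducible stochastic matrix.\<close>

definition plug_in ::
  "'a measure \<Rightarrow> (nat \<Rightarrow> 'a \<Rightarrow> 's::finite) \<Rightarrow> (real^'s^'s \<Rightarrow> real) \<Rightarrow> (nat \<Rightarrow> 'a \<Rightarrow> real) \<Rightarrow> bool" where
  "plug_in M X f Z \<longleftrightarrow>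
     (\<forall>n. Z n \<in> borel_measurable M \<and>
          (\<forall>\<omega>\<in>space M. irreducible_stochastic (P_hat X n \<omega>) \<longrightarrow> Z n \<omega> = f (P_hat X n \<omega>)))"


section \<open>The Gaussian limit\<close>

text \<open>The normal law on the line with mean \<open>m\<close> and variance \<open>v\<close>; degenerate if \<open>v = 0\<close>.\<close>

definition normal_law :: "real \<Rightarrow> real \<Rightarrow> real measure" where
  "normal_law m v =
     (if v = 0 then return borel m else density lborel (\<lambda>x. ennreal (normal_density m (sqrt v) x)))"

definition gaussian_matrix :: "'b measure \<Rightarrow> ('b \<Rightarrow> real^'s^'s) \<Rightarrow> bool" where
  "gaussian_matrix N W \<longleftrightarrow>
     prob_space N \<and> W \<in> borel_measurable N \<and>
     (\<forall>A :: real^'s^'s. \<exists>m v. 0 \<le> v \<and>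
        distr N borel (\<lambda>\<omega>. \<Sum>i\<in>UNIV. \<Sum>j\<in>UNIV. A $ i $ j * W \<omega> $ i $ j) = normal_law m v)"

definition covariance :: "'b measure \<Rightarrow> ('b \<Rightarrow> real) \<Rightarrow> ('b \<Rightarrow> real) \<Rightarrow> real" where
  "covariance N U V = (\<integral>\<omega>. (U \<omega> - (\<integral>\<omega>'. U \<omega>' \<partial>N)) * (V \<omega> - (\<integral>\<omega>'. V \<omega>' \<partial>N)) \<partial>N)"

definition limit_matrix :: "'b measure \<Rightarrow> ('b \<Rightarrow> real^'s^'s) \<Rightarrow> real^'s^'s \<Rightarrow> bool" where
  "limit_matrix N W P \<longleftrightarrow>
     gaussian_matrix N W \<and>
     (\<forall>i j. (\<integral>\<omega>. W \<omega> $ i $ j \<partial>N) = 0) \<and>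
     (\<forall>i j k l. covariance N (\<lambda>\<omega>. W \<omega> $ i $ j) (\<lambda>\<omega>. W \<omega> $ k $ l) =
        (if i = k then P $ i $ j * ((if j = l then 1 else 0) - P $ i $ l) / stationary P $ i else 0))"

definition converges_in_dist ::
  "'a measure \<Rightarrow> (nat \<Rightarrow> 'a \<Rightarrow> real) \<Rightarrow> 'b measure \<Rightarrow> ('b \<Rightarrow> real) \<Rightarrow> bool" where
  "converges_in_dist M Y N V \<longleftrightarrow> weak_conv_m (\<lambda>n. distr M borel (Y n)) (distr N borel V)"

end

theory Submission
  imports Defs
begin

text \<open>
  All three limits come from the delta method along the set of irreducible stochastic matrices:
  a functional that is differentiable at \<open>P\<close> within this set turns the scaled estimation error
  into its derivative, up to an error that vanishes in probability. What remains is, on the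
  deterministic side, the derivatives, and on the probabilistic side, a central limit theorem for
  one real linear functional of the estimation error at a time.

  Derivatives. If \<open>\<rho>\<close> is stationary for \<open>Q\<close> and \<open>\<pi>\<close>, \<open>R\<close> belong to \<open>P\<close>, then
  \<open>\<rho> - \<pi> = \<rho> (Q - P) R\<close> holds exactly (\<open>stationary_increment\<close>), and the inverses of the two
  fundamental matrices satisfy a resolvent identity (\<open>R_stat_increment\<close>). Up to a rank-one
  term that is linear in \<open>\<rho> - \<pi>\<close>, both increments are bilinear in a continuous factor and in
  \<open>Q - P\<close>, so the derivatives of \<open>\<pi>\<close> and \<open>R\<close> can be read off
  (\<open>has_derivative_bilinear_increment\<close>), and those of the functionals follow by the product rule.
  The product rule also produces terms that are absent from the stated formulas; they vanish
  because displacements between stochastic matrices have row sums zero and because \<open>g0\<close> and \<open>h\<close>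
  are centred under \<open>\<pi>\<close>.

  Central limit theorem. The solvability of the Poisson equation \<open>u - P u = c\<close> for centred \<open>c\<close>
  (\<open>poisson_equation\<close>) is used twice. It writes an occupation time minus its stationary mean as a
  bounded term plus a sum of martingale differences, which gives the weak law of large numbers
  \<open>occupation_frequency_vanishes\<close>. And it provides a vector \<open>u\<close> for which \<open>1 - \<theta>\<^sup>2 u / 2\<close> is an
  eigenvector, up to \<open>O(\<theta>\<^sup>3)\<close>, of the transition operator tilted by \<open>exp (i \<theta> f)\<close>, with
  eigenvalue \<open>1 - \<theta>\<^sup>2 \<sigma>\<^sup>2 / 2\<close> (\<open>tilted_approximate_eigenvector\<close>). Iterating the operator \<open>n\<close> times
  at \<open>\<theta> = t / sqrt n\<close> gives the Gaussian characteristic function as the limit for the additive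
  functional of a centred \<open>f\<close> (\<open>additive_char_limit\<close>).

  The two sides meet in \<open>delta_method\<close>: by the law of large numbers a linear functional of
  \<open>sqrt n (P_hat - P)\<close> is asymptotically such an additive functional, a Slutsky argument for
  characteristic functions discards the vanishing errors, and Levy's continuity theorem identifies
  the limit, whose variance is that of the same linear functional of \<open>W\<close>.
\<close>

section \<open>The fundamental matrix of an irreducible chain\<close>

definition const_rows :: "real^'s \<Rightarrow> real^'s^'s" where
  "const_rows v = (\<chi> i j. v $ j)"

lemma const_rows_mult_vec: "const_rows v *v u = (v \<bullet> u) *\<^sub>R (1 :: real^'s::finite)"
  by (simp add: const_rows_def vec_eq_iff matrix_vector_mult_def inner_vec_def)

lemma vec_mult_const_rows: "x v* const_rows v = (x \<bullet> 1) *\<^sub>R (v :: real^'s::finite)"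
  by (simp add: const_rows_def vec_eq_iff vector_matrix_mult_def inner_vec_def sum_distrib_right)

lemma matrix_mult_const_rows:
  fixes A :: "real^'s::finite^'s"
  assumes "A *v 1 = 1"
  shows "A ** const_rows v = const_rows v"
proof -
  have "(\<Sum>k\<in>UNIV. A $ i $ k) = 1" for i
    using assms by (simp add: vec_eq_iff matrix_vector_mult_def)
  then show ?thesis
    by (simp add: const_rows_def vec_eq_iff matrix_matrix_mult_def flip: sum_distrib_right)
qed

lemma const_rows_mult_matrix: "const_rows v ** A = const_rows (v v* (A :: real^'s::finite^'s))"
  by (simp add: const_rows_def vec_eq_iff matrix_matrix_mult_def vector_matrix_mult_def)

lemma matrix_inv_inverse:
  assumes "invertible A"
  shows "A ** matrix_inv A = mat 1" "matrix_inv A ** A = mat 1"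
  using assms someI_ex[of "\<lambda>B. A ** B = mat 1 \<and> B ** A = mat 1"]
  unfolding invertible_def matrix_inv_def by blast+

lemma stochastic_row_sum: "stochastic_matrix P \<Longrightarrow> P *v 1 = (1 :: real^'s::finite)"
  by (simp add: stochastic_matrix_def vec_eq_iff matrix_vector_mult_def)

lemma stochastic_nonneg: "stochastic_matrix P \<Longrightarrow> 0 \<le> P $ i $ j"
  by (simp add: stochastic_matrix_def)

lemma matrix_power_simps [simp]:
  "matrix_power P 0 = mat 1"
  "matrix_power P (Suc n) = P ** matrix_power P n"
  by (simp_all add: matrix_power_def)

lemma stochastic_matrix_power:
  fixes P :: "real^'s::finite^'s"
  assumes "stochastic_matrix P"
  shows "stochastic_matrix (matrix_power P n)"
proof (induction n)
  case 0
  show ?case by (auto simp: stochastic_matrix_def mat_def)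
next
  case (Suc n)
  have "(P ** matrix_power P n) *v 1 = 1"
    using assms Suc by (simp add: stochastic_row_sum flip: matrix_vector_mul_assoc)
  moreover have "0 \<le> (P ** matrix_power P n) $ i $ j" for i j
    using assms Suc by (auto simp: matrix_matrix_mult_def stochastic_matrix_def intro!: sum_nonneg)
  ultimately show ?case
    by (simp add: stochastic_matrix_def vec_eq_iff matrix_vector_mult_def)
qed

text \<open>The maximum principle: at a state where a harmonic function is largest, it is an average
  of its values after \<open>n\<close> steps, and irreducibility lets every state enter such an average
  with positive weight.\<close>

lemma harmonic_constant:
  fixes P :: "real^'s::finite^'s"
  assumes irr: "irreducible_stochastic P" and harm: "P *v u = u"
  shows "\<exists>c. u = c *\<^sub>R 1"
proof -
  have powu: "matrix_power P n *v u = u" for n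
    by (induction n) (simp_all add: harm flip: matrix_vector_mul_assoc)
  define c where "c = Max (range (($) u))"
  have "c \<in> range (($) u)" unfolding c_def by (rule Max_in) auto
  then obtain i where i: "u $ i = c" by auto
  have le: "u $ j \<le> c" for j unfolding c_def by (rule Max_ge) auto
  have "u $ j = c" for j
  proof -
    obtain n where n: "matrix_power P n $ i $ j > 0"
      using irr by (auto simp: irreducible_stochastic_def)
    have st: "stochastic_matrix (matrix_power P n)"
      using irr by (simp add: irreducible_stochastic_def stochastic_matrix_power)
    have "(\<Sum>k\<in>UNIV. matrix_power P n $ i $ k * (c - u $ k))
        = c * (\<Sum>k\<in>UNIV. matrix_power P n $ i $ k) - (matrix_power P n *v u) $ i"
      by (simp add: matrix_vector_mult_def sum_subtractf right_diff_distrib sum_distrib_left)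
         (simp add: mult.commute)
    also have "\<dots> = 0"
      using st i by (simp add: powu stochastic_matrix_def)
    finally have "matrix_power P n $ i $ j * (c - u $ j) = 0"
      using st le by (subst (asm) sum_nonneg_eq_0_iff) (auto simp: stochastic_matrix_def)
    with n show ?thesis by simp
  qed
  then show ?thesis by (intro exI[of _ c]) (simp add: vec_eq_iff)
qed

text \<open>A stochastic matrix maps the probability simplex continuously into itself, so it has a
  fixed point there.\<close>

lemma stationary_exists:
  fixes P :: "real^'s::finite^'s"
  assumes "stochastic_matrix P"
  shows "\<exists>\<pi>. is_stationary P \<pi>"
proof -
  define S where "S = {x :: real^'s. (\<forall>i. 0 \<le> x $ i) \<and> x \<bullet> 1 = 1}"
  have S_eq: "S = (\<Inter>i. {x. 0 \<le> x $ i}) \<inter> {x. x \<bullet> 1 = 1}"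
    by (auto simp: S_def)
  have "closed S"
    unfolding S_eq by (intro closed_Int closed_INT ballI closed_Collect_le closed_Collect_eq continuous_intros)
  moreover have "bounded S"
  proof -
    have "norm x \<le> 1" if "x \<in> S" for x
    proof -
      have "norm x \<le> (\<Sum>i\<in>UNIV. \<bar>x $ i\<bar>)" by (rule norm_le_l1_cart)
      also have "\<dots> = 1" using that by (simp add: S_def inner_vec_def)
      finally show ?thesis .
    qed
    then show ?thesis by (auto simp: bounded_iff)
  qed
  ultimately have "compact S" by (simp add: compact_eq_bounded_closed)
  moreover have "convex S"
    by (auto simp: S_def convex_def inner_add_left)
  moreover have "axis undefined 1 \<in> S"
    by (auto simp: S_def axis_def inner_vec_def)
  then have "S \<noteq> {}" by auto
  moreover have "continuous_on S (\<lambda>x. x v* P)"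
    unfolding vector_matrix_mult_def by (intro continuous_intros)
  moreover have "(\<lambda>x. x v* P) \<in> S \<rightarrow> S"
  proof
    fix x assume "x \<in> S"
    moreover from this have "0 \<le> (x v* P) $ j" for j
      using assms by (auto simp: S_def vector_matrix_mult_def stochastic_nonneg intro!: sum_nonneg)
    ultimately show "x v* P \<in> S"
      using assms by (simp add: S_def dot_lmul_matrix stochastic_row_sum)
  qed
  ultimately obtain x where "x \<in> S" "x v* P = x"
    using brouwer[of S "\<lambda>x. x v* P"] by blast
  then show ?thesis
    by (auto simp: is_stationary_def S_def inner_vec_def)
qed

context
  fixes P :: "real^'s::finite^'s" and \<pi> :: "real^'s"
  assumes irr: "irreducible_stochastic P" and stat: "is_stationary P \<pi>"
begin

lemma fundamental_mult_vec:
  "(mat 1 - P + const_rows \<pi>) *v u = u - P *v u + (\<pi> \<bullet> u) *\<^sub>R 1"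
  by (simp add: matrix_vector_mult_add_rdistrib matrix_vector_mult_diff_rdistrib const_rows_mult_vec)

lemma vec_mult_fundamental:
  "x v* (mat 1 - P + const_rows \<pi>) = x - x v* P + (x \<bullet> 1) *\<^sub>R \<pi>"
  by (simp add: vector_matrix_mult_add_rdistrib vector_matrix_mult_diff_rdistrib vec_mult_const_rows
      vector_matrix_left_distrib)

text \<open>The kernel of \<open>I - P\<close> consists of the constant vectors, and the rank-one correction is
  nonzero on those.\<close>

lemma invertible_fundamental: "invertible (mat 1 - P + const_rows \<pi>)"
proof -
  have "u = 0" if "(mat 1 - P + const_rows \<pi>) *v u = 0" for u
  proof -
    have "\<pi> \<bullet> u = (\<pi> v* (mat 1 - P + const_rows \<pi>)) \<bullet> u"
      using stat by (simp add: vec_mult_fundamental is_stationary_def inner_vec_def)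
    also have "\<dots> = 0" by (simp only: dot_lmul_matrix that inner_zero_right)
    finally have 0: "\<pi> \<bullet> u = 0" .
    then have "P *v u = u" using that by (simp add: fundamental_mult_vec)
    then obtain c where c: "u = c *\<^sub>R 1" using harmonic_constant[OF irr] by blast
    have "\<pi> \<bullet> 1 = 1" using stat by (simp add: is_stationary_def inner_vec_def)
    with 0 c show ?thesis by simp
  qed
  then show ?thesis
    unfolding invertible_left_inverse matrix_left_invertible_ker by blast
qed

lemma stationary_unique: "is_stationary P \<rho> \<Longrightarrow> \<rho> = \<pi>"
proof -
  let ?A = "mat 1 - P + const_rows \<pi>"
  assume "is_stationary P \<rho>"
  then have "\<rho> v* ?A = \<pi> v* ?A"
    using stat by (simp add: vec_mult_fundamental is_stationary_def inner_vec_def)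
  then have "\<rho> v* ?A v* matrix_inv ?A = \<pi> v* ?A v* matrix_inv ?A" by simp
  then show ?thesis
    using matrix_inv_inverse[OF invertible_fundamental] by (simp add: vector_matrix_mul_assoc)
qed

lemma stationary_pos: "0 < \<pi> $ j"
proof -
  have "\<exists>i. \<pi> $ i > 0"
  proof (rule ccontr)
    assume "\<not> ?thesis"
    then have "(\<Sum>i\<in>UNIV. \<pi> $ i) \<le> 0" by (intro sum_nonpos) (auto simp: not_less)
    then show False using stat by (simp add: is_stationary_def)
  qed
  then obtain i where i: "\<pi> $ i > 0" by blast
  obtain n where n: "matrix_power P n $ i $ j > 0"
    using irr by (auto simp: irreducible_stochastic_def)
  have "\<pi> v* matrix_power P n = \<pi>"
    using stat by (induction n) (simp_all add: is_stationary_def flip: vector_matrix_mul_assoc)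
  then have "\<pi> $ j = (\<Sum>k\<in>UNIV. \<pi> $ k * matrix_power P n $ k $ j)"
    by (metis (lifting) ext vec_lambda_beta vector_matrix_mult_def)
  also have "\<dots> > 0"
    using i n stat irr
    by (intro sum_pos2[of _ i])
       (auto simp: is_stationary_def irreducible_stochastic_def
         intro!: mult_nonneg_nonneg stochastic_nonneg stochastic_matrix_power)
  finally show ?thesis .
qed

end

context
  fixes P :: "real^'s::finite^'s"
  assumes irr: "irreducible_stochastic P"
begin

lemma stationary_is_stationary: "is_stationary P (stationary P)"
  unfolding stationary_def
proof (rule theI')
  show "\<exists>!\<pi>. is_stationary P \<pi>"
    using stationary_exists[of P] stationary_unique[OF irr] irr
    by (auto simp: irreducible_stochastic_def)
qed

lemma stationary_inner_1: "stationary P \<bullet> 1 = 1"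
  using stationary_is_stationary by (simp add: is_stationary_def inner_vec_def)

lemma stationary_fixed: "stationary P v* P = stationary P"
  using stationary_is_stationary by (simp add: is_stationary_def)

lemma R_stat_inverse:
  "R_stat P ** (mat 1 - P + const_rows (stationary P)) = mat 1"
  "(mat 1 - P + const_rows (stationary P)) ** R_stat P = mat 1"
  using invertible_fundamental[OF irr stationary_is_stationary]
  unfolding R_stat_def const_rows_def[symmetric]
  by (simp_all add: matrix_inv_inverse)

lemma R_stat_1: "R_stat P *v 1 = 1"
proof -
  have "(mat 1 - P + const_rows (stationary P)) *v 1 = 1"
    using irr by (simp add: fundamental_mult_vec[OF irr stationary_is_stationary] stationary_inner_1
        stochastic_row_sum irreducible_stochastic_def)
  then have "R_stat P *v 1 = R_stat P *v ((mat 1 - P + const_rows (stationary P)) *v 1)" by simp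
  then show ?thesis by (simp add: matrix_vector_mul_assoc R_stat_inverse)
qed

lemma stationary_R_stat: "stationary P v* R_stat P = stationary P"
proof -
  have "stationary P v* (mat 1 - P + const_rows (stationary P)) = stationary P"
    by (simp add: vec_mult_fundamental[OF irr stationary_is_stationary] stationary_inner_1
        stationary_fixed)
  then have "stationary P v* R_stat P
      = (stationary P v* (mat 1 - P + const_rows (stationary P))) v* R_stat P" by simp
  then show ?thesis by (simp add: vector_matrix_mul_assoc R_stat_inverse)
qed

text \<open>For centred right-hand sides the fundamental matrix solves the Poisson equation: the
  rank-one correction does not see a vector orthogonal to the stationary one.\<close>

lemma poisson_equation:
  assumes "stationary P \<bullet> c = 0"
  shows "R_stat P *v c - P *v (R_stat P *v c) = c"
proof -
  have "stationary P \<bullet> (R_stat P *v c) = 0"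
    using assms by (simp add: stationary_R_stat flip: dot_lmul_matrix)
  moreover have "(mat 1 - P + const_rows (stationary P)) *v (R_stat P *v c) = c"
    by (simp add: matrix_vector_mul_assoc R_stat_inverse)
  ultimately show ?thesis
    by (simp add: fundamental_mult_vec[OF irr stationary_is_stationary])
qed

end

section \<open>Irreducibility is stable under perturbation\<close>

text \<open>Only the support of a matrix matters for irreducibility, and a larger support has more
  paths.\<close>

lemma irreducible_if_support_superset:
  fixes P Q :: "real^'s::finite^'s"
  assumes irr: "irreducible_stochastic P" and Q: "stochastic_matrix Q"
    and supp: "\<And>i j. 0 < P $ i $ j \<Longrightarrow> 0 < Q $ i $ j"
  shows "irreducible_stochastic Q"
proof -
  have "0 < matrix_power Q n $ i $ j" if "0 < matrix_power P n $ i $ j" for n i j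
    using that
  proof (induction n arbitrary: i)
    case 0
    then show ?case by simp
  next
    case (Suc n)
    have "\<exists>k. 0 < P $ i $ k * matrix_power P n $ k $ j"
    proof (rule ccontr)
      assume "\<not> ?thesis"
      then have "(\<Sum>k\<in>UNIV. P $ i $ k * matrix_power P n $ k $ j) \<le> 0"
        by (intro sum_nonpos) (auto simp: not_less)
      with Suc.prems show False by (simp add: matrix_matrix_mult_def)
    qed
    then obtain k where "0 < P $ i $ k * matrix_power P n $ k $ j" by blast
    moreover have "0 \<le> P $ i $ k"
      using irr by (simp add: irreducible_stochastic_def stochastic_nonneg)
    ultimately have "0 < Q $ i $ k" "0 < matrix_power Q n $ k $ j"
      using supp Suc.IH by (auto simp: zero_less_mult_iff)
    then have "0 < (\<Sum>k\<in>UNIV. Q $ i $ k * matrix_power Q n $ k $ j)"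
      using Q by (intro sum_pos2[of _ k])
        (auto intro!: mult_nonneg_nonneg stochastic_nonneg stochastic_matrix_power)
    then show ?case by (simp add: matrix_matrix_mult_def)
  qed
  then show ?thesis
    using irr Q unfolding irreducible_stochastic_def by metis
qed

text \<open>A uniform radius exists because only finitely many entries are positive.\<close>

lemma irreducible_near:
  fixes P :: "real^'s::finite^'s"
  assumes "irreducible_stochastic P"
  obtains \<delta> where "\<delta> > 0" "\<And>Q i j. (\<And>i j. \<bar>Q $ i $ j - P $ i $ j\<bar> < \<delta>) \<Longrightarrow> 0 < P $ i $ j \<Longrightarrow> 0 < Q $ i $ j"
proof -
  define \<delta> where "\<delta> = Min (insert 1 {P $ i $ j | i j. 0 < P $ i $ j})"
  have fin: "finite {P $ i $ j | i j. 0 < P $ i $ j}"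
    by (rule finite_subset[of _ "range (\<lambda>(i, j). P $ i $ j)"]) auto
  show thesis
  proof
    show "\<delta> > 0" using fin by (auto simp: \<delta>_def)
    fix Q :: "real^'s^'s" and i j
    assume Q: "\<And>i j. \<bar>Q $ i $ j - P $ i $ j\<bar> < \<delta>" and "0 < P $ i $ j"
    then have "\<delta> \<le> P $ i $ j" using fin unfolding \<delta>_def by (intro Min_le) auto
    with Q[of i j] show "0 < Q $ i $ j" by linarith
  qed
qed

section \<open>Differentiability on the set of irreducible stochastic matrices\<close>

lemma bounded_bilinear_matrix_mult:
  "bounded_bilinear ((**) :: real^'n::finite^'m::finite \<Rightarrow> real^'p::finite^'n \<Rightarrow> real^'p^'m)"
  unfolding bilinear_conv_bounded_bilinear[symmetric] bilinear_def
  by (auto intro!: linearI simp: matrix_matrix_mult_def vec_eq_iff sum_distrib_left mult_ac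
      sum.distrib distrib_left)

lemma bounded_bilinear_matrix_vec:
  "bounded_bilinear ((*v) :: real^'n::finite^'m::finite \<Rightarrow> real^'n \<Rightarrow> real^'m)"
  unfolding bilinear_conv_bounded_bilinear[symmetric] bilinear_def
  by (auto intro!: linearI simp: matrix_vector_mult_def vec_eq_iff sum_distrib_left mult_ac
      sum.distrib distrib_left)

lemma bounded_bilinear_vec_matrix:
  "bounded_bilinear ((v*) :: real^'n::finite \<Rightarrow> real^'m::finite^'n \<Rightarrow> real^'m)"
  unfolding bilinear_conv_bounded_bilinear[symmetric] bilinear_def
  by (auto intro!: linearI simp: vector_matrix_mult_def vec_eq_iff sum_distrib_left mult_ac
      sum.distrib distrib_left)

lemma bounded_linear_const_rows: "bounded_linear (const_rows :: real^'s::finite \<Rightarrow> real^'s^'s)"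
  unfolding linear_conv_bounded_linear[symmetric]
  by (auto intro!: linearI simp: const_rows_def vec_eq_iff)

lemma bounded_linear_diag_matrix: "bounded_linear (diag_matrix :: real^'s::finite \<Rightarrow> real^'s^'s)"
  unfolding linear_conv_bounded_linear[symmetric]
  by (auto intro!: linearI simp: diag_matrix_def vec_eq_iff)

lemma diag_matrix_mult_vec: "diag_matrix v *v w = (\<chi> i. v $ i * (w $ i :: real))"
  for v :: "real^'s::finite"
  by (simp add: diag_matrix_def matrix_vector_mult_def vec_eq_iff if_distrib[of "\<lambda>x. x * _"]
      cong: if_cong)

text \<open>Caratheodory's view of differentiability: an increment that is exactly bilinear in a
  continuous factor and the displacement is differentiable, whatever the regularity of the
  factor.\<close>

lemma has_derivative_bilinear_increment:
  assumes B: "bounded_bilinear B" and g: "(g \<longlongrightarrow> g P) (at P within S)"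
    and h: "\<And>Q. Q \<in> S \<Longrightarrow> h Q = h P + B (g Q) (Q - P)"
  shows "(h has_derivative B (g P)) (at P within S)"
proof -
  interpret bounded_bilinear B by fact
  obtain K where K: "\<And>a b. norm (B a b) \<le> norm a * norm b * K" "0 < K"
    using pos_bounded by blast
  have lim: "((\<lambda>Q. norm (g Q - g P) * K) \<longlongrightarrow> 0) (at P within S)"
    by (intro tendsto_mult_left_zero tendsto_norm_zero Lim_null[THEN iffD1] g)
  have "\<forall>\<^sub>F Q in at P within S.
      norm ((1 / norm (Q - P)) *\<^sub>R (h Q - (h P + B (g P) (Q - P)))) \<le> norm (g Q - g P) * K"
  proof (unfold eventually_at_filter, intro always_eventually allI impI)
    fix Q assume "Q \<noteq> P" "Q \<in> S"
    then have "h Q - (h P + B (g P) (Q - P)) = B (g Q - g P) (Q - P)"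
      by (simp add: h diff_left)
    then show "norm ((1 / norm (Q - P)) *\<^sub>R (h Q - (h P + B (g P) (Q - P)))) \<le> norm (g Q - g P) * K"
      using K(1)[of "g Q - g P" "Q - P"] \<open>Q \<noteq> P\<close> by (simp add: field_simps)
  qed
  then show ?thesis
    unfolding has_derivative_within
    by (intro conjI bounded_linear_right Lim_null_comparison[OF _ lim])
qed

text \<open>Within a set, only the values of the derivative on displacements that stay in the set are
  determined.\<close>

lemma has_derivative_within_cong:
  assumes "(f has_derivative L) (at P within S)" "bounded_linear L'"
    and "\<And>Q. Q \<in> S \<Longrightarrow> L (Q - P) = L' (Q - P)"
  shows "(f has_derivative L') (at P within S)"
  using assms unfolding has_derivative_within
  by (auto elim!: tendsto_cong[THEN iffD1, rotated] simp: eventually_at_filter)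

abbreviation irreducibles :: "(real^'s::finite^'s) set" where
  "irreducibles \<equiv> Collect irreducible_stochastic"

text \<open>Multiplying \<open>\<rho> - \<pi>\<close> by the inverse of the fundamental matrix of \<open>P\<close> leaves \<open>\<rho> (Q - P)\<close>,
  because \<open>\<rho> Q = \<rho>\<close>.\<close>

lemma stationary_increment:
  fixes P Q :: "real^'s::finite^'s"
  assumes P: "irreducible_stochastic P" and Q: "irreducible_stochastic Q"
  shows "stationary Q = stationary P + stationary Q v* ((Q - P) ** R_stat P)"
proof -
  let ?A = "mat 1 - P + const_rows (stationary P)"
  have "stationary Q v* ?A = stationary P + stationary Q v* (Q - P)"
    using stationary_inner_1[OF Q] stationary_fixed[OF Q]
    unfolding vec_mult_fundamental[OF P stationary_is_stationary[OF P]]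
    by (simp add: vector_matrix_mult_diff_rdistrib algebra_simps)
  then have "stationary Q v* ?A v* R_stat P = (stationary P + stationary Q v* (Q - P)) v* R_stat P"
    by simp
  then show ?thesis
    by (simp add: vector_matrix_mul_assoc R_stat_inverse[OF P] vector_matrix_left_distrib
        stationary_R_stat[OF P])
qed

text \<open>The resolvent identity for the inverses of the two fundamental matrices; the rank-one
  parts simplify because \<open>R\<close> fixes the vector of ones.\<close>

lemma R_stat_increment:
  fixes P Q :: "real^'s::finite^'s"
  assumes P: "irreducible_stochastic P" and Q: "irreducible_stochastic Q"
  shows "R_stat Q = R_stat P + R_stat Q ** ((Q - P) ** R_stat P)
    - const_rows ((stationary Q - stationary P) v* R_stat P)"
proof -
  let ?A = "mat 1 - P + const_rows (stationary P)"
  let ?B = "mat 1 - Q + const_rows (stationary Q)"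
  have AB: "?A - ?B = (Q - P) - const_rows (stationary Q - stationary P)"
    by (simp add: linear_diff[OF bounded_linear.linear[OF bounded_linear_const_rows]])
  have "R_stat Q ** (?A - ?B) ** R_stat P = R_stat Q ** ((Q - P) ** R_stat P)
      - R_stat Q ** const_rows (stationary Q - stationary P) ** R_stat P"
    unfolding AB
    by (simp only: bounded_bilinear.diff_right[OF bounded_bilinear_matrix_mult]
        bounded_bilinear.diff_left[OF bounded_bilinear_matrix_mult] matrix_mul_assoc)
  moreover have "R_stat Q ** (?A - ?B) ** R_stat P
      = R_stat Q ** (?A ** R_stat P) - (R_stat Q ** ?B) ** R_stat P"
    by (simp only: bounded_bilinear.diff_right[OF bounded_bilinear_matrix_mult]
        bounded_bilinear.diff_left[OF bounded_bilinear_matrix_mult] matrix_mul_assoc)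
  moreover have "\<dots> = R_stat Q - R_stat P"
    by (simp only: R_stat_inverse[OF P] R_stat_inverse[OF Q] matrix_mul_lid matrix_mul_rid)
  moreover have "R_stat Q ** const_rows (stationary Q - stationary P) ** R_stat P
      = const_rows ((stationary Q - stationary P) v* R_stat P)"
    by (simp only: matrix_mult_const_rows[OF R_stat_1[OF Q]] const_rows_mult_matrix)
  ultimately show ?thesis
    by (metis (no_types, lifting) add_diff_eq diff_add_cancel add.commute)
qed

lemma norm_stationary_le: "irreducible_stochastic Q \<Longrightarrow> norm (stationary Q) \<le> 1"
  for Q :: "real^'s::finite^'s"
proof -
  assume "irreducible_stochastic Q"
  then have "is_stationary Q (stationary Q)" by (rule stationary_is_stationary)
  then have "(\<Sum>i\<in>UNIV. \<bar>stationary Q $ i\<bar>) = 1" by (simp add: is_stationary_def)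
  with norm_le_l1_cart[of "stationary Q"] show ?thesis by simp
qed

context
  fixes P :: "real^'s::finite^'s"
  assumes irr: "irreducible_stochastic P"
begin

lemma bounded_bilinear_increment_terms:
  "bounded_bilinear (\<lambda>x (H :: real^'s^'s). x v* (H ** R_stat P))"
  "bounded_bilinear (\<lambda>(A :: real^'s^'s) (H :: real^'s^'s). A ** (H ** R_stat P))"
  by (intro bounded_bilinear.comp[OF bounded_bilinear_vec_matrix]
        bounded_bilinear.comp[OF bounded_bilinear_matrix_mult] bounded_linear_ident
        bounded_bilinear.bounded_linear_left[OF bounded_bilinear_matrix_mult])+

lemma displacement_Zfun: "Zfun (\<lambda>Q. Q - P) (at P within S)"
  unfolding tendsto_Zfun_iff[symmetric] by (rule tendsto_ident_at)

lemma eventually_irreducibles: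
  "eventually irreducible_stochastic (at P within irreducibles)"
  by (simp add: eventually_at_filter)

lemma stationary_tendsto: "(stationary \<longlongrightarrow> stationary P) (at P within irreducibles)"
proof -
  have "Bfun stationary (at P within irreducibles)"
    using eventually_irreducibles
    by (intro BfunI[of _ 1]) (auto elim!: eventually_mono simp: norm_stationary_le)
  then have "Zfun (\<lambda>Q. stationary Q v* ((Q - P) ** R_stat P)) (at P within irreducibles)"
    using bounded_bilinear.Bfun_prod_Zfun[OF bounded_bilinear_increment_terms(1)] displacement_Zfun by blast
  then have "((\<lambda>Q. stationary P + stationary Q v* ((Q - P) ** R_stat P)) \<longlongrightarrow> stationary P + 0)
      (at P within irreducibles)"
    by (intro tendsto_intros) (simp add: tendsto_Zfun_iff)
  then show ?thesis
    using stationary_increment[OF irr]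
    by (subst tendsto_cong[OF eventually_mono[OF eventually_irreducibles]]) auto
qed

lemma stationary_has_derivative:
  "(stationary has_derivative (\<lambda>H. stationary P v* (H ** R_stat P))) (at P within irreducibles)"
  using stationary_increment[OF irr]
  by (intro has_derivative_bilinear_increment[OF bounded_bilinear_increment_terms(1) stationary_tendsto]) auto

text \<open>The increment formula bounds \<open>R_stat Q\<close> by an absorption argument: for small
  displacements the term that contains \<open>R_stat Q\<close> on the right is at most half the left side.\<close>

lemma R_stat_tendsto: "(R_stat \<longlongrightarrow> R_stat P) (at P within irreducibles)"
proof -
  let ?F = "at P within irreducibles"
  obtain K where K: "\<And>(A :: real^'s^'s) H. norm (A ** (H ** R_stat P)) \<le> norm A * norm H * K" "0 < K"
    using bounded_bilinear.pos_bounded[OF bounded_bilinear_increment_terms(2)] by blast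
  let ?c = "\<lambda>Q. const_rows ((stationary Q - stationary P) v* R_stat P)"
  have "((\<lambda>Q. const_rows ((stationary Q - stationary P) v* R_stat P)) \<longlongrightarrow>
      const_rows ((stationary P - stationary P) v* R_stat P)) ?F"
    by (intro bounded_linear.tendsto[OF bounded_linear_const_rows]
        bounded_bilinear.tendsto[OF bounded_bilinear_vec_matrix] tendsto_intros stationary_tendsto)
  then have c: "(?c \<longlongrightarrow> 0) ?F"
    by (simp add: linear_0[OF bounded_linear.linear[OF bounded_linear_const_rows]])
  have "\<forall>\<^sub>F Q in ?F. norm (?c Q) < 1"
    using tendstoD[OF c, of 1] by simp
  moreover have "\<forall>\<^sub>F Q in ?F. norm (Q - P) < 1 / (2 * K)"
    using tendstoD[OF tendsto_ident_at[of P irreducibles], of "1 / (2 * K)"] K(2)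
    by (simp add: dist_norm)
  ultimately have "\<forall>\<^sub>F Q in ?F. norm (R_stat Q) \<le> 2 * (norm (R_stat P) + 1)"
    using eventually_irreducibles
  proof eventually_elim
    case (elim Q)
    have "norm (R_stat Q) \<le> norm (R_stat P) + norm (R_stat Q ** ((Q - P) ** R_stat P)) + norm (?c Q)"
      by (subst R_stat_increment[OF irr elim(3)])
         (intro order.trans[OF norm_triangle_ineq4] add_right_mono norm_triangle_ineq)
    also have "\<dots> \<le> norm (R_stat P) + norm (R_stat Q) * (norm (Q - P) * K) + 1"
      using K(1)[of "R_stat Q" "Q - P"] elim(1) by (simp add: mult.assoc)
    also have "\<dots> \<le> norm (R_stat P) + norm (R_stat Q) * (1 / 2) + 1"
      using elim(2) K(2) by (intro add_mono mult_left_mono) (auto simp: field_simps)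
    finally show ?case by simp
  qed
  then have "Bfun R_stat ?F" by (rule BfunI)
  then have "Zfun (\<lambda>Q. R_stat Q ** ((Q - P) ** R_stat P)) ?F"
    using bounded_bilinear.Bfun_prod_Zfun[OF bounded_bilinear_increment_terms(2)] displacement_Zfun by blast
  then have "((\<lambda>Q. R_stat P + R_stat Q ** ((Q - P) ** R_stat P) - ?c Q) \<longlongrightarrow> R_stat P + 0 - 0) ?F"
    by (intro tendsto_intros c) (simp add: tendsto_Zfun_iff)
  then show ?thesis
    using R_stat_increment[OF irr]
    by (subst tendsto_cong[OF eventually_mono[OF eventually_irreducibles]]) auto
qed

lemma R_stat_has_derivative:
  "(R_stat has_derivative (\<lambda>H. R_stat P ** (H ** R_stat P)
      - const_rows (stationary P v* (H ** R_stat P) v* R_stat P))) (at P within irreducibles)"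
proof -
  let ?h = "\<lambda>Q. R_stat Q ** ((Q - P) ** R_stat P)"
  have "(?h has_derivative (\<lambda>H. R_stat P ** (H ** R_stat P))) (at P within irreducibles)"
    by (rule has_derivative_bilinear_increment[OF bounded_bilinear_increment_terms(2) R_stat_tendsto])
       (simp add: bounded_bilinear.zero_right[OF bounded_bilinear_matrix_mult]
          bounded_bilinear.zero_left[OF bounded_bilinear_matrix_mult])
  moreover have "bounded_linear (\<lambda>w. const_rows (w v* R_stat P))"
    by (intro bounded_linear_compose[OF bounded_linear_const_rows]
        bounded_bilinear.bounded_linear_left[OF bounded_bilinear_vec_matrix])
  from bounded_linear.has_derivative[OF this has_derivative_diff[OF stationary_has_derivative
      has_derivative_const[of "stationary P"]]]
  have "((\<lambda>Q. const_rows ((stationary Q - stationary P) v* R_stat P)) has_derivative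
      (\<lambda>H. const_rows (stationary P v* (H ** R_stat P) v* R_stat P))) (at P within irreducibles)"
    by simp
  ultimately have "((\<lambda>Q. R_stat P + ?h Q - const_rows ((stationary Q - stationary P) v* R_stat P))
      has_derivative (\<lambda>H. 0 + R_stat P ** (H ** R_stat P)
      - const_rows (stationary P v* (H ** R_stat P) v* R_stat P))) (at P within irreducibles)"
    by (intro has_derivative_diff has_derivative_add has_derivative_const)
  then have "((\<lambda>Q. R_stat P + ?h Q - const_rows ((stationary Q - stationary P) v* R_stat P))
      has_derivative (\<lambda>H. R_stat P ** (H ** R_stat P)
      - const_rows (stationary P v* (H ** R_stat P) v* R_stat P))) (at P within irreducibles)"
    by simp
  then show ?thesis
    by (rule has_derivative_transform[rotated -1]) (use irr R_stat_increment[OF irr] in auto)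
qed

lemma displacement_row_sum:
  "irreducible_stochastic Q \<Longrightarrow> (Q - P) *v 1 = 0"
  using irr by (simp add: matrix_vector_mult_diff_rdistrib stochastic_row_sum irreducible_stochastic_def)

end

section \<open>The derivatives of the three functionals\<close>

context
  fixes P :: "real^'s::finite^'s"
  assumes irr: "irreducible_stochastic P"
begin

lemma stationary_inner_g0: "stationary P \<bullet> g0_fun g P = 0"
  by (simp add: g0_fun_def mu_fun_def inner_diff_right stationary_inner_1[OF irr])

lemma stationary_inner_h: "stationary P \<bullet> h_fun g P = 0"
  by (simp add: h_fun_def stationary_inner_g0 stationary_R_stat[OF irr] flip: dot_lmul_matrix)

text \<open>The product rule produces, besides the two terms of the formula, terms in which \<open>g0\<close> or
  \<open>R_stat\<close> moves by a multiple of the vector of ones; these vanish because \<open>g0\<close> and \<open>h\<close> are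
  centred under the stationary vector.\<close>

lemma phi_has_derivative: "(phi g has_derivative phi_deriv g P) (at P within irreducibles)"
proof -
  define d\<pi> where "d\<pi> = (\<lambda>H. stationary P v* (H ** R_stat P))"
  define dR where "dR = (\<lambda>H. R_stat P ** (H ** R_stat P) - const_rows (d\<pi> H v* R_stat P))"
  define dg where "dg = (\<lambda>H. - (d\<pi> H \<bullet> g) *\<^sub>R (1 :: real^'s))"
  define dh where "dh = (\<lambda>H. R_stat P *v dg H + dR H *v g0_fun g P)"
  define had where "had = (\<lambda>v w :: real^'s. diag_matrix v *v w)"
  have had: "bounded_bilinear had"
    unfolding had_def
    by (intro bounded_bilinear.comp1[OF bounded_bilinear_matrix_vec] bounded_linear_diag_matrix)
  have had_sym: "had v w = had w v" for v w
    by (simp add: had_def diag_matrix_mult_vec mult.commute)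
  have had_1: "had v (c *\<^sub>R 1) = c *\<^sub>R v" for v c
    by (simp add: had_def diag_matrix_mult_vec vec_eq_iff mult.commute)
  note \<pi>' = stationary_has_derivative[OF irr, folded d\<pi>_def]
  note R' = R_stat_has_derivative[OF irr, folded dR_def[unfolded d\<pi>_def]]
  have g': "(g0_fun g has_derivative dg) (at P within irreducibles)"
    unfolding g0_fun_def[abs_def] mu_fun_def[abs_def] dg_def
    by (auto intro!: derivative_eq_intros \<pi>')
  have h': "(h_fun g has_derivative dh) (at P within irreducibles)"
    unfolding h_fun_def[abs_def] dh_def
    by (rule bounded_bilinear.FDERIV[OF bounded_bilinear_matrix_vec R' g'])
  have "((\<lambda>Q. 2 * (stationary Q \<bullet> had (g0_fun g Q) (h_fun g Q))
      - stationary Q \<bullet> had (g0_fun g Q) (g0_fun g Q)) has_derivative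
    (\<lambda>H. 2 * (stationary P \<bullet> (had (g0_fun g P) (dh H) + had (dg H) (h_fun g P))
          + d\<pi> H \<bullet> had (g0_fun g P) (h_fun g P))
      - (stationary P \<bullet> (had (g0_fun g P) (dg H) + had (dg H) (g0_fun g P))
          + d\<pi> H \<bullet> had (g0_fun g P) (g0_fun g P)))) (at P within irreducibles)"
    by (intro has_derivative_diff has_derivative_mult_right has_derivative_inner \<pi>'
        bounded_bilinear.FDERIV[OF had] g' h')
  moreover have "phi g = (\<lambda>Q. 2 * (stationary Q \<bullet> had (g0_fun g Q) (h_fun g Q))
      - stationary Q \<bullet> had (g0_fun g Q) (g0_fun g Q))"
    by (simp add: phi_def[abs_def] had_def)
  moreover have "2 * (stationary P \<bullet> (had (g0_fun g P) (dh H) + had (dg H) (h_fun g P))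
          + d\<pi> H \<bullet> had (g0_fun g P) (h_fun g P))
      - (stationary P \<bullet> (had (g0_fun g P) (dg H) + had (dg H) (g0_fun g P))
          + d\<pi> H \<bullet> had (g0_fun g P) (g0_fun g P)) = phi_deriv g P H" for H
  proof -
    have dg: "stationary P \<bullet> had v (dg H) = - (d\<pi> H \<bullet> g) * (stationary P \<bullet> v)" for v
      by (simp add: dg_def had_1[of _ "- _", simplified])
    obtain c where "dh H = (R_stat P ** H) *v h_fun g P + c *\<^sub>R 1"
    proof
      have "R_stat P *v (a *\<^sub>R 1) = a *\<^sub>R 1" for a
        using linear_scale[OF bounded_linear.linear[OF
              bounded_bilinear.bounded_linear_right[OF bounded_bilinear_matrix_vec, of "R_stat P"]],
            of a "1"] R_stat_1[OF irr] by simp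
      from this[of "- (d\<pi> H \<bullet> g)"]
      show "dh H = (R_stat P ** H) *v h_fun g P
          + (- (d\<pi> H \<bullet> g) - (d\<pi> H v* R_stat P) \<bullet> g0_fun g P) *\<^sub>R 1"
        by (simp add: dh_def dg_def dR_def h_fun_def matrix_vector_mult_diff_rdistrib
            const_rows_mult_vec matrix_vector_mul_assoc matrix_mul_assoc algebra_simps)
    qed
    then have dh: "stationary P \<bullet> had (g0_fun g P) (dh H)
        = stationary P \<bullet> had (g0_fun g P) ((R_stat P ** H) *v h_fun g P)"
      by (simp add: bounded_bilinear.add_right[OF had] had_1 inner_add_right stationary_inner_g0)
    have "stationary P \<bullet> had (g0_fun g P) ((R_stat P ** H) *v h_fun g P)
        = (stationary P v* (diag_matrix (g0_fun g P) ** R_stat P ** H)) \<bullet> h_fun g P"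
      by (simp add: had_def dot_lmul_matrix matrix_vector_mul_assoc matrix_mul_assoc)
    moreover have "phi_deriv g P H
        = d\<pi> H \<bullet> (2 *\<^sub>R had (g0_fun g P) (h_fun g P) - had (g0_fun g P) (g0_fun g P))
          + 2 * ((stationary P v* (diag_matrix (g0_fun g P) ** R_stat P ** H)) \<bullet> h_fun g P)"
      by (simp add: phi_deriv_def had_def d\<pi>_def)
    ultimately show ?thesis
      unfolding had_sym[of "dg H"] inner_add_right dg stationary_inner_g0 stationary_inner_h dh
      by (simp add: inner_diff_right)
  qed
  ultimately show ?thesis by (simp only:)
qed

text \<open>A tangent direction keeps \<open>P\<close> in the set of irreducible stochastic matrices for a short
  time in both senses, so the derivative within that set is a two-sided derivative along the
  line.\<close>

lemma line_irreducible:
  assumes H: "H \<in> tangent_space P"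
  shows "\<exists>\<epsilon>>0. \<forall>t. \<bar>t\<bar> < \<epsilon> \<longrightarrow> irreducible_stochastic (P + t *\<^sub>R H)"
proof -
  obtain \<delta> where \<delta>: "\<delta> > 0"
    "\<And>Q i j. (\<And>i j. \<bar>Q $ i $ j - P $ i $ j\<bar> < \<delta>) \<Longrightarrow> 0 < P $ i $ j \<Longrightarrow> 0 < Q $ i $ j"
    using irreducible_near[OF irr] by blast
  have st: "stochastic_matrix P" using irr by (simp add: irreducible_stochastic_def)
  show ?thesis
  proof (intro exI[of _ "\<delta> / (norm H + 1)"] conjI allI impI)
    show "0 < \<delta> / (norm H + 1)" using \<delta>(1) by (intro divide_pos_pos) (auto simp: add_nonneg_pos)
    fix t assume t: "\<bar>t\<bar> < \<delta> / (norm H + 1)"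
    let ?Q = "P + t *\<^sub>R H"
    have "\<bar>?Q $ i $ j - P $ i $ j\<bar> < \<delta>" for i j
    proof -
      have "\<bar>H $ i $ j\<bar> \<le> norm H"
        using Finite_Cartesian_Product.norm_nth_le[of "H $ i" j]
          Finite_Cartesian_Product.norm_nth_le[of H i] by simp
      then have "\<bar>t\<bar> * \<bar>H $ i $ j\<bar> \<le> \<bar>t\<bar> * (norm H + 1)" by (intro mult_left_mono) auto
      also have "\<dots> < \<delta>" using t by (simp add: pos_less_divide_eq add_nonneg_pos)
      finally show ?thesis by (simp add: abs_mult)
    qed
    then have pos: "0 < P $ i $ j \<Longrightarrow> 0 < ?Q $ i $ j" for i j using \<delta>(2)[of ?Q] by blast
    have "0 \<le> ?Q $ i $ j" for i j
    proof (cases "P $ i $ j = 0")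
      case True
      with H show ?thesis by (simp add: tangent_space_def)
    next
      case False
      with stochastic_nonneg[OF st, of i j] have "0 < P $ i $ j" by linarith
      then show ?thesis using pos[of i j] by (simp only: less_imp_le)
    qed
    moreover have "(\<Sum>j\<in>UNIV. ?Q $ i $ j) = 1" for i
    proof -
      have "(\<Sum>j\<in>UNIV. H $ i $ j) = 0"
        using H by (simp add: tangent_space_def matrix_vector_mult_def vec_eq_iff)
      then show ?thesis
        using st by (simp add: stochastic_matrix_def sum.distrib flip: sum_distrib_left)
    qed
    ultimately have "stochastic_matrix ?Q" unfolding stochastic_matrix_def by blast
    with pos show "irreducible_stochastic ?Q" by (rule irreducible_if_support_superset[OF irr, rotated])
  qed
qed

lemma directional_derivative:
  assumes f: "(f has_derivative L) (at P within irreducibles)" and H: "H \<in> tangent_space P"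
  shows "((\<lambda>t. f (P + t *\<^sub>R H)) has_real_derivative L H) (at 0)"
proof -
  obtain \<epsilon> where \<epsilon>: "\<epsilon> > 0" "\<And>t. \<bar>t\<bar> < \<epsilon> \<Longrightarrow> irreducible_stochastic (P + t *\<^sub>R H)"
    using line_irreducible[OF H] by blast
  let ?\<gamma> = "\<lambda>t :: real. P + t *\<^sub>R H"
  have "(?\<gamma> has_derivative (\<lambda>t. t *\<^sub>R H)) (at 0 within ball 0 \<epsilon>)"
    by (auto intro!: derivative_eq_intros)
  moreover have "(f has_derivative L) (at (?\<gamma> 0) within ?\<gamma> ` ball 0 \<epsilon>)"
    using \<epsilon>(2) by (auto intro!: has_derivative_subset[OF f])
  ultimately have "((\<lambda>t. f (?\<gamma> t)) has_derivative (\<lambda>t. L (t *\<^sub>R H))) (at 0 within ball 0 \<epsilon>)"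
    by (rule has_derivative_in_compose)
  moreover have "L (t *\<^sub>R H) = L H * t" for t
    using has_derivative_linear[OF f] by (simp add: linear_scale mult.commute)
  ultimately show ?thesis
    using \<epsilon>(1) by (simp add: has_field_derivative_def at_within_open[of 0 "ball 0 \<epsilon>"])
qed

text \<open>The rank-one part of the derivative of \<open>R_stat\<close> has trace \<open>\<pi> H R R 1 = \<pi> H 1\<close>, which is zero
  on displacements between stochastic matrices.\<close>

lemma kemeny_has_derivative:
  "(kemeny has_derivative (\<lambda>H. trace (R_stat P ** H ** R_stat P))) (at P within irreducibles)"
proof (rule has_derivative_within_cong)
  have tr: "bounded_linear (trace :: real^'s^'s \<Rightarrow> real)"
    unfolding linear_conv_bounded_linear[symmetric]
    by (auto intro!: linearI simp: trace_def sum.distrib sum_distrib_left)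
  show "(kemeny has_derivative (\<lambda>H. trace (R_stat P ** (H ** R_stat P)
      - const_rows (stationary P v* (H ** R_stat P) v* R_stat P)))) (at P within irreducibles)"
    unfolding kemeny_def[abs_def]
    by (rule bounded_linear.has_derivative[OF tr R_stat_has_derivative[OF irr]])
  show "bounded_linear (\<lambda>H. trace (R_stat P ** H ** R_stat P))"
    by (intro bounded_linear_compose[OF tr]
        bounded_linear_compose[OF bounded_bilinear.bounded_linear_left[OF bounded_bilinear_matrix_mult]]
        bounded_bilinear.bounded_linear_right[OF bounded_bilinear_matrix_mult])
  fix Q :: "real^'s^'s" assume "Q \<in> irreducibles"
  then have "(Q - P) *v 1 = 0" using displacement_row_sum[OF irr] by simp
  then have "(stationary P v* ((Q - P) ** R_stat P) v* R_stat P) \<bullet> 1 = 0"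
    by (simp add: dot_lmul_matrix R_stat_1[OF irr] flip: matrix_vector_mul_assoc)
  then have "trace (const_rows (stationary P v* ((Q - P) ** R_stat P) v* R_stat P)) = 0"
    by (simp add: trace_def const_rows_def inner_vec_def)
  then show "trace (R_stat P ** ((Q - P) ** R_stat P)
      - const_rows (stationary P v* ((Q - P) ** R_stat P) v* R_stat P))
      = trace (R_stat P ** (Q - P) ** R_stat P)"
    by (simp add: linear_diff[OF bounded_linear.linear[OF tr]] matrix_mul_assoc)
qed

lemma entropy_rate_has_derivative:
  assumes pos: "\<And>i j. 0 < P $ i $ j"
  shows "(entropy_rate has_derivative (\<lambda>H. (stationary P v* (H ** R_stat P)) \<bullet> row_entropy P
      - (\<Sum>i\<in>UNIV. stationary P $ i * (\<Sum>j\<in>UNIV. H $ i $ j * ln (P $ i $ j)))))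
    (at P within irreducibles)"
proof (rule has_derivative_within_cong)
  define d\<pi> where "d\<pi> = (\<lambda>H. stationary P v* (H ** R_stat P))"
  note \<pi>' = stationary_has_derivative[OF irr, folded d\<pi>_def]
  have entry: "((\<lambda>Q :: real^'s^'s. Q $ i $ j) has_derivative (\<lambda>H. H $ i $ j)) F" for i j F
    by (intro bounded_linear_imp_has_derivative bounded_linear_compose[OF bounded_linear_vec_nth]
        bounded_linear_vec_nth)
  have "((\<lambda>Q :: real^'s^'s. Q $ i $ j * ln (Q $ i $ j)) has_derivative
      (\<lambda>H. H $ i $ j * ln (P $ i $ j) + H $ i $ j)) (at P within irreducibles)" for i j
    using pos[of i j] by (auto intro!: derivative_eq_intros entry simp: algebra_simps)
  then show "(entropy_rate has_derivative (\<lambda>H. - (\<Sum>i\<in>UNIV.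
      stationary P $ i * (\<Sum>j\<in>UNIV. H $ i $ j * ln (P $ i $ j) + H $ i $ j)
      + d\<pi> H $ i * (\<Sum>j\<in>UNIV. P $ i $ j * ln (P $ i $ j))))) (at P within irreducibles)"
    unfolding entropy_rate_def[abs_def]
    by (intro has_derivative_minus has_derivative_sum has_derivative_mult
        bounded_linear.has_derivative[OF bounded_linear_vec_nth \<pi>'])
  have "bounded_linear (\<lambda>H. d\<pi> H \<bullet> row_entropy P)"
    by (intro bounded_linear_compose[OF bounded_linear_inner_left] has_derivative_bounded_linear[OF \<pi>'])
  then show "bounded_linear (\<lambda>H :: real^'s^'s. (stationary P v* (H ** R_stat P)) \<bullet> row_entropy P
      - (\<Sum>i\<in>UNIV. stationary P $ i * (\<Sum>j\<in>UNIV. H $ i $ j * ln (P $ i $ j))))"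
    unfolding d\<pi>_def
    by (intro bounded_linear_sub bounded_linear_sum bounded_linear_const_mult
        bounded_linear_mult_const bounded_linear_compose[OF bounded_linear_vec_nth]
        bounded_linear_vec_nth)
  fix Q :: "real^'s^'s" assume "Q \<in> irreducibles"
  then have "(\<Sum>j\<in>UNIV. (Q - P) $ i $ j) = 0" for i
    using displacement_row_sum[OF irr] by (simp add: matrix_vector_mult_def vec_eq_iff)
  then show "- (\<Sum>i\<in>UNIV.
      stationary P $ i * (\<Sum>j\<in>UNIV. (Q - P) $ i $ j * ln (P $ i $ j) + (Q - P) $ i $ j)
      + d\<pi> (Q - P) $ i * (\<Sum>j\<in>UNIV. P $ i $ j * ln (P $ i $ j)))
    = (stationary P v* ((Q - P) ** R_stat P)) \<bullet> row_entropy P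
      - (\<Sum>i\<in>UNIV. stationary P $ i * (\<Sum>j\<in>UNIV. (Q - P) $ i $ j * ln (P $ i $ j)))"
    by (simp only: sum.distrib d\<pi>_def)
       (simp add: row_entropy_def inner_vec_def sum_negf)
qed

end

section \<open>Vanishing and boundedness in probability\<close>

context prob_space
begin

definition vanishes_in_prob :: "(nat \<Rightarrow> 'a \<Rightarrow> real) \<Rightarrow> bool" where
  "vanishes_in_prob Y \<longleftrightarrow> (\<forall>n. random_variable borel (Y n)) \<and>
     (\<forall>\<epsilon>>0. (\<lambda>n. prob {\<omega>\<in>space M. \<epsilon> < \<bar>Y n \<omega>\<bar>}) \<longlonglongrightarrow> 0)"

definition bounded_in_prob :: "(nat \<Rightarrow> 'a \<Rightarrow> real) \<Rightarrow> bool" where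
  "bounded_in_prob Y \<longleftrightarrow> (\<forall>n. random_variable borel (Y n)) \<and>
     (\<forall>\<alpha>>0. \<exists>K. \<forall>\<^sub>F n in sequentially. prob {\<omega>\<in>space M. K < \<bar>Y n \<omega>\<bar>} < \<alpha>)"

lemma vanishes_in_prob_alt:
  "vanishes_in_prob Y \<longleftrightarrow> (\<forall>n. random_variable borel (Y n)) \<and>
     (\<forall>\<epsilon>>0. \<forall>\<alpha>>0. \<forall>\<^sub>F n in sequentially. prob {\<omega>\<in>space M. \<epsilon> < \<bar>Y n \<omega>\<bar>} < \<alpha>)"
  by (simp add: vanishes_in_prob_def tendsto_iff dist_norm)

lemma vanishes_in_prob_measurable: "vanishes_in_prob Y \<Longrightarrow> random_variable borel (Y n)"
  by (simp add: vanishes_in_prob_def)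

lemma vanishes_in_probD:
  "vanishes_in_prob Y \<Longrightarrow> \<epsilon> > 0 \<Longrightarrow> \<alpha> > 0 \<Longrightarrow>
    \<forall>\<^sub>F n in sequentially. prob {\<omega>\<in>space M. \<epsilon> < \<bar>Y n \<omega>\<bar>} < \<alpha>"
  by (simp add: vanishes_in_prob_alt)

lemma bounded_in_prob_measurable: "bounded_in_prob Y \<Longrightarrow> random_variable borel (Y n)"
  by (simp add: bounded_in_prob_def)

lemma bounded_in_probE:
  assumes "bounded_in_prob Y" "\<alpha> > 0"
  obtains K where "\<forall>\<^sub>F n in sequentially. prob {\<omega>\<in>space M. K < \<bar>Y n \<omega>\<bar>} < \<alpha>"
  using assms by (auto simp: bounded_in_prob_def)

lemma vanishes_in_prob_imp_bounded: "vanishes_in_prob Y \<Longrightarrow> bounded_in_prob Y"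
  unfolding vanishes_in_prob_alt bounded_in_prob_def by (auto intro!: exI[of _ 1])

lemma prob_less_by_union:
  fixes Y Z :: "'a \<Rightarrow> real"
  assumes [measurable]: "random_variable borel Y" "random_variable borel Z"
    and sub: "A \<subseteq> {\<omega>\<in>space M. a < \<bar>Y \<omega>\<bar>} \<union> {\<omega>\<in>space M. b < \<bar>Z \<omega>\<bar>}"
    and "prob {\<omega>\<in>space M. a < \<bar>Y \<omega>\<bar>} < \<alpha> / 2" "prob {\<omega>\<in>space M. b < \<bar>Z \<omega>\<bar>} < \<alpha> / 2"
  shows "prob A < \<alpha>"
proof -
  have "prob A \<le> prob ({\<omega>\<in>space M. a < \<bar>Y \<omega>\<bar>} \<union> {\<omega>\<in>space M. b < \<bar>Z \<omega>\<bar>})"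
    by (rule finite_measure_mono[OF sub]) measurable
  also have "\<dots> \<le> prob {\<omega>\<in>space M. a < \<bar>Y \<omega>\<bar>} + prob {\<omega>\<in>space M. b < \<bar>Z \<omega>\<bar>}"
    by (rule measure_Un_le) measurable
  finally show ?thesis using assms(4,5) by simp
qed

lemma vanishes_in_prob_add:
  assumes Y: "vanishes_in_prob Y" and Z: "vanishes_in_prob Z"
  shows "vanishes_in_prob (\<lambda>n \<omega>. Y n \<omega> + Z n \<omega>)"
proof -
  note [measurable] = Y[THEN vanishes_in_prob_measurable]
    Z[THEN vanishes_in_prob_measurable]
  have "\<forall>\<^sub>F n in sequentially. prob {\<omega>\<in>space M. \<epsilon> < \<bar>Y n \<omega> + Z n \<omega>\<bar>} < \<alpha>"
    if "\<epsilon> > 0" "\<alpha> > 0" for \<epsilon> \<alpha>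
  proof -
    have "\<forall>\<^sub>F n in sequentially. prob {\<omega>\<in>space M. \<epsilon>/2 < \<bar>Y n \<omega>\<bar>} < \<alpha>/2"
         "\<forall>\<^sub>F n in sequentially. prob {\<omega>\<in>space M. \<epsilon>/2 < \<bar>Z n \<omega>\<bar>} < \<alpha>/2"
      using that by (intro vanishes_in_probD Y Z; simp)+
    then show ?thesis
      by eventually_elim (rule prob_less_by_union[of "Y _" "Z _" _ "\<epsilon>/2" "\<epsilon>/2"], auto)
  qed
  then show ?thesis unfolding vanishes_in_prob_alt by simp
qed

lemma bounded_in_prob_add:
  assumes Y: "bounded_in_prob Y" and Z: "bounded_in_prob Z"
  shows "bounded_in_prob (\<lambda>n \<omega>. Y n \<omega> + Z n \<omega>)"
proof -
  note [measurable] = Y[THEN bounded_in_prob_measurable]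
    Z[THEN bounded_in_prob_measurable]
  have "\<exists>K. \<forall>\<^sub>F n in sequentially. prob {\<omega>\<in>space M. K < \<bar>Y n \<omega> + Z n \<omega>\<bar>} < \<alpha>"
    if "\<alpha> > 0" for \<alpha>
  proof -
    obtain K where K: "\<forall>\<^sub>F n in sequentially. prob {\<omega>\<in>space M. K < \<bar>Y n \<omega>\<bar>} < \<alpha>/2"
      using \<open>\<alpha> > 0\<close> by (elim bounded_in_probE[OF Y half_gt_zero])
    obtain L where L: "\<forall>\<^sub>F n in sequentially. prob {\<omega>\<in>space M. L < \<bar>Z n \<omega>\<bar>} < \<alpha>/2"
      using \<open>\<alpha> > 0\<close> by (elim bounded_in_probE[OF Z half_gt_zero])
    from K L have "\<forall>\<^sub>F n in sequentially. prob {\<omega>\<in>space M. K + L < \<bar>Y n \<omega> + Z n \<omega>\<bar>} < \<alpha>"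
      by eventually_elim (rule prob_less_by_union[of "Y _" "Z _" _ K L], auto)
    then show ?thesis by blast
  qed
  then show ?thesis unfolding bounded_in_prob_def by simp
qed

lemma bounded_in_prob_const: "bounded_in_prob (\<lambda>n \<omega>. c)"
  unfolding bounded_in_prob_def by (auto intro!: exI[of _ "\<bar>c\<bar>"])

text \<open>This is how vanishing is transferred below: \<open>D\<close> is an error already known to vanish, \<open>U\<close> a
  quantity of the right order of magnitude, and \<open>Y\<close> is controlled only where \<open>D\<close> is small. It
  covers products, continuous images, and the remainder in the definition of a derivative.\<close>

lemma vanishes_in_prob_if_small_multiple:
  assumes D: "vanishes_in_prob D" and U: "bounded_in_prob U"
    and Y [measurable]: "\<And>n. random_variable borel (Y n)"
    and small: "\<And>\<epsilon>. \<epsilon> > 0 \<Longrightarrow> \<exists>\<delta>>0. \<forall>n. \<forall>\<omega>\<in>space M. \<bar>D n \<omega>\<bar> < \<delta> \<longrightarrow> \<bar>Y n \<omega>\<bar> \<le> \<epsilon> * \<bar>U n \<omega>\<bar>"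
  shows "vanishes_in_prob Y"
proof -
  note [measurable] = D[THEN vanishes_in_prob_measurable]
    U[THEN bounded_in_prob_measurable]
  have "\<forall>\<^sub>F n in sequentially. prob {\<omega>\<in>space M. \<epsilon> < \<bar>Y n \<omega>\<bar>} < \<alpha>"
    if "\<epsilon> > 0" "\<alpha> > 0" for \<epsilon> \<alpha>
  proof -
    obtain K where K: "\<forall>\<^sub>F n in sequentially. prob {\<omega>\<in>space M. K < \<bar>U n \<omega>\<bar>} < \<alpha>/2"
      using \<open>\<alpha> > 0\<close> by (elim bounded_in_probE[OF U half_gt_zero])
    define K' where "K' = max K 1"
    have "K' > 0" by (simp add: K'_def)
    then obtain \<delta> where \<delta>: "\<delta> > 0"
      "\<And>n \<omega>. \<omega> \<in> space M \<Longrightarrow> \<bar>D n \<omega>\<bar> < \<delta> \<Longrightarrow> \<bar>Y n \<omega>\<bar> \<le> (\<epsilon> / K') * \<bar>U n \<omega>\<bar>"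
      using small[of "\<epsilon> / K'"] \<open>\<epsilon> > 0\<close> by auto
    have "\<forall>\<^sub>F n in sequentially. prob {\<omega>\<in>space M. \<delta>/2 < \<bar>D n \<omega>\<bar>} < \<alpha>/2"
      using that \<delta>(1) by (intro vanishes_in_probD D) simp_all
    then show ?thesis using K
    proof eventually_elim
      case (elim n)
      have "\<delta>/2 < \<bar>D n \<omega>\<bar>" if "\<omega> \<in> space M" "\<epsilon> < \<bar>Y n \<omega>\<bar>" "\<not> K < \<bar>U n \<omega>\<bar>" for \<omega>
      proof (rule ccontr)
        assume "\<not> ?thesis"
        then have "\<bar>Y n \<omega>\<bar> \<le> (\<epsilon> / K') * \<bar>U n \<omega>\<bar>" using \<delta> that(1) by simp
        also have "\<dots> \<le> (\<epsilon> / K') * K'"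
          using that(3) \<open>\<epsilon> > 0\<close> \<open>K' > 0\<close> by (intro mult_left_mono) (auto simp: K'_def)
        finally show False using that(2) \<open>K' > 0\<close> by simp
      qed
      then show ?case
        by (intro prob_less_by_union[of "D n" "U n", OF _ _ _ elim]) auto
    qed
  qed
  then show ?thesis unfolding vanishes_in_prob_alt by simp
qed

lemma vanishes_in_prob_mult:
  assumes U: "bounded_in_prob U" and D: "vanishes_in_prob D"
  shows "vanishes_in_prob (\<lambda>n \<omega>. U n \<omega> * D n \<omega>)"
proof (rule vanishes_in_prob_if_small_multiple[OF D U])
  note [measurable] = D[THEN vanishes_in_prob_measurable]
    U[THEN bounded_in_prob_measurable]
  show "random_variable borel (\<lambda>\<omega>. U n \<omega> * D n \<omega>)" for n by measurable
  show "\<exists>\<delta>>0. \<forall>n. \<forall>\<omega>\<in>space M. \<bar>D n \<omega>\<bar> < \<delta> \<longrightarrow> \<bar>U n \<omega> * D n \<omega>\<bar> \<le> \<epsilon> * \<bar>U n \<omega>\<bar>" if "\<epsilon> > 0" for \<epsilon>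
    using that by (intro exI[of _ \<epsilon>]) (auto simp: abs_mult mult.commute[of \<epsilon>] intro!: mult_left_mono)
qed

lemma vanishes_in_prob_cmult: "vanishes_in_prob D \<Longrightarrow> vanishes_in_prob (\<lambda>n \<omega>. c * D n \<omega>)"
  by (rule vanishes_in_prob_mult[OF bounded_in_prob_const])

lemma bounded_in_prob_cmult:
  assumes Y: "bounded_in_prob Y"
  shows "bounded_in_prob (\<lambda>n \<omega>. c * Y n \<omega>)"
proof -
  note [measurable] = Y[THEN bounded_in_prob_measurable]
  have "\<exists>K. \<forall>\<^sub>F n in sequentially. prob {\<omega>\<in>space M. K < \<bar>c * Y n \<omega>\<bar>} < \<alpha>" if "\<alpha> > 0" for \<alpha>
  proof -
    obtain K where K: "\<forall>\<^sub>F n in sequentially. prob {\<omega>\<in>space M. K < \<bar>Y n \<omega>\<bar>} < \<alpha>"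
      using \<open>\<alpha> > 0\<close> by (elim bounded_in_probE[OF Y])
    have "K < y" if "\<bar>c\<bar> * K < \<bar>c\<bar> * y" for y
      using that by (rule mult_left_less_imp_less) simp
    then have "{\<omega>\<in>space M. \<bar>c\<bar> * K < \<bar>c * Y n \<omega>\<bar>} \<subseteq> {\<omega>\<in>space M. K < \<bar>Y n \<omega>\<bar>}" for n
      by (auto simp: abs_mult)
    then have "prob {\<omega>\<in>space M. \<bar>c\<bar> * K < \<bar>c * Y n \<omega>\<bar>} \<le> prob {\<omega>\<in>space M. K < \<bar>Y n \<omega>\<bar>}" for n
      by (intro finite_measure_mono) measurable
    with K show ?thesis by (intro exI[of _ "\<bar>c\<bar> * K"]) (auto elim!: eventually_mono intro: le_less_trans)
  qed
  then show ?thesis unfolding bounded_in_prob_def by simp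
qed

lemma bounded_in_prob_abs: "bounded_in_prob Y \<Longrightarrow> bounded_in_prob (\<lambda>n \<omega>. \<bar>Y n \<omega>\<bar>)"
  by (auto simp: bounded_in_prob_def intro!: borel_measurable_abs)

lemma vanishes_in_prob_abs: "vanishes_in_prob Y \<Longrightarrow> vanishes_in_prob (\<lambda>n \<omega>. \<bar>Y n \<omega>\<bar>)"
  by (auto simp: vanishes_in_prob_def intro!: borel_measurable_abs)

lemma vanishes_in_prob_const:
  assumes "a \<longlonglongrightarrow> 0"
  shows "vanishes_in_prob (\<lambda>n \<omega>. a n)"
proof -
  have "\<forall>\<^sub>F n in sequentially. prob {\<omega>\<in>space M. \<epsilon> < \<bar>a n\<bar>} < \<alpha>" if "\<epsilon> > 0" "\<alpha> > 0" for \<epsilon> \<alpha>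
    using tendstoD[OF assms \<open>\<epsilon> > 0\<close>] \<open>\<alpha> > 0\<close> by (auto elim!: eventually_mono simp: dist_norm)
  then show ?thesis by (simp add: vanishes_in_prob_alt)
qed

lemma vanishes_in_prob_sum:
  "finite I \<Longrightarrow> (\<And>i. i \<in> I \<Longrightarrow> vanishes_in_prob (Y i)) \<Longrightarrow> vanishes_in_prob (\<lambda>n \<omega>. \<Sum>i\<in>I. Y i n \<omega>)"
  by (induction I rule: finite_induct) (auto intro: vanishes_in_prob_add vanishes_in_prob_const)

lemma bounded_in_prob_sum:
  "finite I \<Longrightarrow> (\<And>i. i \<in> I \<Longrightarrow> bounded_in_prob (Y i)) \<Longrightarrow> bounded_in_prob (\<lambda>n \<omega>. \<Sum>i\<in>I. Y i n \<omega>)"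
  by (induction I rule: finite_induct) (auto intro: bounded_in_prob_add bounded_in_prob_const)

lemma bounded_in_prob_if_second_moment:
  assumes Y [measurable]: "\<And>n. random_variable borel (Y n)"
    and int: "\<And>n. integrable M (\<lambda>\<omega>. (Y n \<omega>)\<^sup>2)"
    and bd: "\<And>n. expectation (\<lambda>\<omega>. (Y n \<omega>)\<^sup>2) \<le> C"
  shows "bounded_in_prob Y"
proof -
  have "\<exists>K. \<forall>\<^sub>F n in sequentially. prob {\<omega>\<in>space M. K < \<bar>Y n \<omega>\<bar>} < \<alpha>" if "\<alpha> > 0" for \<alpha>
  proof (intro exI always_eventually allI)
    fix n
    have "C \<ge> 0"
      by (rule order.trans[OF Bochner_Integration.integral_nonneg bd[of 0]]) simp
    define K where "K = sqrt ((C + 1) / \<alpha>)"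
    have K: "K > 0" "K\<^sup>2 = (C + 1) / \<alpha>" using that \<open>C \<ge> 0\<close> by (auto simp: K_def)
    have "prob {\<omega>\<in>space M. K < \<bar>Y n \<omega>\<bar>} \<le> prob {\<omega>\<in>space M. (Y n \<omega>)\<^sup>2 \<ge> K\<^sup>2}"
      using K(1) by (intro finite_measure_mono) (auto simp flip: abs_le_square_iff)
    also have "\<dots> \<le> expectation (\<lambda>\<omega>. (Y n \<omega>)\<^sup>2) / K\<^sup>2"
      using K(1) by (intro integral_Markov_inequality_measure[where A="{}"] int) auto
    also have "\<dots> \<le> C / K\<^sup>2" using K(1) by (intro divide_right_mono bd) auto
    also have "\<dots> < \<alpha>" using that \<open>C \<ge> 0\<close> by (simp add: K(2) field_simps)
    finally show "prob {\<omega>\<in>space M. sqrt ((C + 1) / \<alpha>) < \<bar>Y n \<omega>\<bar>} < \<alpha>" by (simp add: K_def)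
  qed
  then show ?thesis by (simp add: bounded_in_prob_def)
qed

lemma char_distr: "random_variable borel Y \<Longrightarrow> char (distr M borel Y) t = expectation (\<lambda>\<omega>. iexp (t * Y \<omega>))"
  by (simp add: char_def integral_distr)

text \<open>Slutsky's lemma for characteristic functions: \<open>iexp\<close> is bounded and Lipschitz, so the two
  expectations differ by the size of the difference where that is small, and by the
  probability that it is large.\<close>

lemma char_diff_tendsto_0:
  assumes Y [measurable]: "\<And>n. random_variable borel (Y n)"
    and T [measurable]: "\<And>n. random_variable borel (T n)"
    and van: "vanishes_in_prob (\<lambda>n \<omega>. Y n \<omega> - T n \<omega>)"
  shows "(\<lambda>n. char (distr M borel (Y n)) t - char (distr M borel (T n)) t) \<longlonglongrightarrow> 0"
proof (rule tendstoI)
  fix e :: real assume "e > 0"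
  define \<epsilon> where "\<epsilon> = e / (2 * (\<bar>t\<bar> + 1))"
  have \<epsilon>: "\<epsilon> > 0" "\<bar>t\<bar> * \<epsilon> \<le> e / 2"
    using \<open>e > 0\<close> by (auto simp: \<epsilon>_def field_simps intro!: add_nonneg_pos)
  have bd: "norm (iexp (t * y) - iexp (t * z)) \<le> min 2 (\<bar>t\<bar> * \<bar>y - z\<bar>)" for y z
  proof -
    have "norm (iexp (t * y) - iexp (t * z)) \<le> norm (iexp (t * y)) + norm (iexp (t * z))"
      by (rule norm_triangle_ineq4)
    then have 2: "norm (iexp (t * y) - iexp (t * z)) \<le> 2" by (simp only: norm_exp_i_times)
    have "iexp (t * y) - iexp (t * z) = iexp (t * z) * (iexp (t * (y - z)) - 1)"
      by (simp add: algebra_simps flip: exp_add)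
    then have "norm (iexp (t * y) - iexp (t * z)) = norm (iexp (t * (y - z)) - 1)"
      by (simp only: norm_mult norm_exp_i_times mult_1_left)
    also have "\<dots> \<le> \<bar>t * (y - z)\<bar>"
      using iexp_approx1[of "t * (y - z)" 0] by simp
    finally show ?thesis using 2 by (simp add: abs_mult)
  qed
  have "\<forall>\<^sub>F n in sequentially. prob {\<omega>\<in>space M. \<epsilon> < \<bar>Y n \<omega> - T n \<omega>\<bar>} < e / 4"
    using \<epsilon>(1) \<open>e > 0\<close> by (intro vanishes_in_probD[OF van]) auto
  then show "\<forall>\<^sub>F n in sequentially.
      dist (char (distr M borel (Y n)) t - char (distr M borel (T n)) t) 0 < e"
  proof eventually_elim
    case (elim n)
    have int: "integrable M (\<lambda>\<omega>. iexp (t * Y n \<omega>))" "integrable M (\<lambda>\<omega>. iexp (t * T n \<omega>))"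
      by (auto intro!: integrable_const_bound[of _ 1])
    let ?B = "{\<omega>\<in>space M. \<epsilon> < \<bar>Y n \<omega> - T n \<omega>\<bar>}"
    have intB: "integrable M (\<lambda>\<omega>. \<bar>t\<bar> * \<epsilon> + 2 * indicator ?B \<omega>)"
      by (intro Bochner_Integration.integrable_add integrable_mult_right integrable_real_indicator)
         (auto simp: emeasure_eq_measure)
    have "norm (char (distr M borel (Y n)) t - char (distr M borel (T n)) t)
        = norm (expectation (\<lambda>\<omega>. iexp (t * Y n \<omega>) - iexp (t * T n \<omega>)))"
      using int by (simp add: char_distr)
    also have "\<dots> \<le> expectation (\<lambda>\<omega>. norm (iexp (t * Y n \<omega>) - iexp (t * T n \<omega>)))"
      by (rule integral_norm_bound)
    also have "\<dots> \<le> expectation (\<lambda>\<omega>. \<bar>t\<bar> * \<epsilon> + 2 * indicator ?B \<omega>)"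
    proof (intro integral_mono intB integrable_norm Bochner_Integration.integrable_diff int)
      fix \<omega> assume "\<omega> \<in> space M"
      have "min 2 (\<bar>t\<bar> * \<bar>Y n \<omega> - T n \<omega>\<bar>) \<le> \<bar>t\<bar> * \<epsilon> + 2 * indicator ?B \<omega>"
      proof (cases "\<omega> \<in> ?B")
        case True
        then show ?thesis using \<epsilon>(1) by (intro min.coboundedI1) simp
      next
        case False
        then show ?thesis using \<open>\<omega> \<in> space M\<close>
          by (intro min.coboundedI2) (auto intro!: mult_left_mono)
      qed
      with bd show "norm (iexp (t * Y n \<omega>) - iexp (t * T n \<omega>)) \<le> \<bar>t\<bar> * \<epsilon> + 2 * indicator ?B \<omega>"
        by (rule order.trans)
    qed
    also have "\<dots> = \<bar>t\<bar> * \<epsilon> + 2 * prob ?B"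
      by (subst Bochner_Integration.integral_add) (auto simp: prob_space emeasure_eq_measure)
    also have "\<dots> < e" using elim \<epsilon>(2) by simp
    finally show ?case by (simp add: dist_norm)
  qed
qed

lemma converges_in_dist_via_char:
  assumes Y: "\<And>n. random_variable borel (Y n)" and T: "\<And>n. random_variable borel (T n)"
    and van: "vanishes_in_prob (\<lambda>n \<omega>. Y n \<omega> - T n \<omega>)"
    and N: "prob_space N" "V \<in> borel_measurable N"
    and lim: "\<And>t. (\<lambda>n. char (distr M borel (T n)) t) \<longlonglongrightarrow> char (distr N borel V) t"
  shows "converges_in_dist M Y N V"
  unfolding converges_in_dist_def
proof (rule levy_continuity)
  show "real_distribution (distr M borel (Y n))" for n
    using Y by simp
  show "real_distribution (distr N borel V)"
    using prob_space.real_distribution_distr[OF N] .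
  show "(\<lambda>n. char (distr M borel (Y n)) t) \<longlonglongrightarrow> char (distr N borel V) t" for t
    using tendsto_add[OF char_diff_tendsto_0[OF Y T van, of t] lim[of t]] by simp
qed

end

section \<open>Centred Gaussian laws\<close>

text \<open>This reduces moments and characteristic functions, in the degenerate case as well, to those
  of the standard normal law.\<close>

lemma normal_law_affine:
  assumes "0 \<le> v"
  shows "normal_law m v = distr std_normal_distribution borel (\<lambda>x. m + sqrt v * x)"
proof (cases "v = 0")
  case True
  interpret prob_space std_normal_distribution by (rule prob_space_normal_density) simp
  show ?thesis
    using True distr_const[of m borel] by (simp add: normal_law_def)
next
  case False
  with assms have v: "0 < v" by simp
  interpret prob_space std_normal_distribution by (rule prob_space_normal_density) simp
  have "distributed std_normal_distribution lborel (\<lambda>x. x) std_normal_density"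
    unfolding distributed_def by (intro conjI distr_id2) simp_all
  from normal_density_affine[OF this, of "sqrt v" m] v
  have "distr std_normal_distribution lborel (\<lambda>x. m + sqrt v * x)
      = density lborel (normal_density m (sqrt v))"
    by (simp add: distributed_def)
  moreover have "distr std_normal_distribution lborel (\<lambda>x. m + sqrt v * x)
      = distr std_normal_distribution borel (\<lambda>x. m + sqrt v * x)"
    by (intro distr_cong) simp_all
  ultimately show ?thesis using v by (simp add: normal_law_def)
qed

lemma normal_law_moments:
  assumes "0 \<le> v"
  shows "(\<integral>x. x \<partial>normal_law m v) = m" "integrable (normal_law m v) (\<lambda>x. x\<^sup>2)"
    "(\<integral>x. x\<^sup>2 \<partial>normal_law m v) = m\<^sup>2 + v"
proof -
  interpret prob_space std_normal_distribution by (rule prob_space_normal_density) simp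
  have 1: "(\<integral>x. x \<partial>std_normal_distribution) = 0" "integrable std_normal_distribution (\<lambda>x. x)"
    using integral_std_normal_distribution_moment_odd[of 1]
      integrable_std_normal_distribution_moment[of 1] by auto
  have 2: "(\<integral>x. x\<^sup>2 \<partial>std_normal_distribution) = 1" "integrable std_normal_distribution (\<lambda>x. x\<^sup>2)"
    using std_normal_distribution_even_moments[of 1] by (auto simp: fact_numeral)
  have sq: "(m + sqrt v * x)\<^sup>2 = m\<^sup>2 + 2 * m * sqrt v * x + v * x\<^sup>2" for x
    using assms by (simp add: power2_sum power_mult_distrib algebra_simps)
  have "(\<integral>x. m + sqrt v * x \<partial>std_normal_distribution)
      = (\<integral>x. m \<partial>std_normal_distribution) + (\<integral>x. sqrt v * x \<partial>std_normal_distribution)"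
    by (intro Bochner_Integration.integral_add integrable_const integrable_mult_right 1)
  also have "\<dots> = m"
    unfolding integral_mult_right_zero 1 using prob_space by (simp del: space_density)
  finally show "(\<integral>x. x \<partial>normal_law m v) = m"
    unfolding normal_law_affine[OF assms] by (subst integral_distr) simp_all
  show "integrable (normal_law m v) (\<lambda>x. x\<^sup>2)"
    unfolding normal_law_affine[OF assms]
    by (subst integrable_distr_eq, simp, simp, unfold sq)
       (intro Bochner_Integration.integrable_add integrable_const integrable_mult_right 1 2)
  have "(\<integral>x. (m + sqrt v * x)\<^sup>2 \<partial>std_normal_distribution)
      = (\<integral>x. m\<^sup>2 \<partial>std_normal_distribution) + (\<integral>x. 2 * m * sqrt v * x \<partial>std_normal_distribution)
        + (\<integral>x. v * x\<^sup>2 \<partial>std_normal_distribution)"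
    unfolding sq
    by (subst Bochner_Integration.integral_add Bochner_Integration.integral_add,
        (intro Bochner_Integration.integrable_add integrable_const integrable_mult_right 1 2)+)+ simp
  also have "\<dots> = m\<^sup>2 + v"
    unfolding integral_mult_right_zero 1 2 using prob_space by (simp del: space_density)
  finally show "(\<integral>x. x\<^sup>2 \<partial>normal_law m v) = m\<^sup>2 + v"
    unfolding normal_law_affine[OF assms] by (subst integral_distr) simp_all
qed

lemma char_normal_law:
  assumes "0 \<le> v"
  shows "char (normal_law 0 v) t = complex_of_real (exp (- (t\<^sup>2 * v) / 2))"
proof -
  have "char (normal_law 0 v) t = char std_normal_distribution (t * sqrt v)"
    unfolding normal_law_affine[OF assms] char_def
    by (subst integral_distr) (simp_all add: mult_ac)
  also have "\<dots> = complex_of_real (exp (- ((t * sqrt v)\<^sup>2) / 2))"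
    by (simp only: char_std_normal_distribution)
  also have "(t * sqrt v)\<^sup>2 = t\<^sup>2 * v"
    using assms by (simp add: power_mult_distrib)
  finally show ?thesis .
qed

text \<open>A centred Gaussian law is determined by its variance, and the variance of a linear
  functional of \<open>W\<close> is a quadratic form in the covariances.\<close>

lemma limit_matrix_linear_functional:
  fixes W :: "'b \<Rightarrow> real^'s::finite^'s" and A P :: "real^'s^'s"
  assumes lim: "limit_matrix N W P"
  defines "\<sigma>2 \<equiv> (\<Sum>i\<in>UNIV. ((\<Sum>j\<in>UNIV. P $ i $ j * (A $ i $ j)\<^sup>2)
      - (\<Sum>j\<in>UNIV. P $ i $ j * A $ i $ j)\<^sup>2) / stationary P $ i)"
  shows "distr N borel (\<lambda>\<omega>. \<Sum>i\<in>UNIV. \<Sum>j\<in>UNIV. A $ i $ j * W \<omega> $ i $ j) = normal_law 0 \<sigma>2"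
    and "0 \<le> \<sigma>2"
proof -
  have gauss: "gaussian_matrix N W" and mean: "\<And>i j. (\<integral>\<omega>. W \<omega> $ i $ j \<partial>N) = 0"
    and cov: "\<And>i j k l. covariance N (\<lambda>\<omega>. W \<omega> $ i $ j) (\<lambda>\<omega>. W \<omega> $ k $ l) =
        (if i = k then P $ i $ j * ((if j = l then 1 else 0) - P $ i $ l) / stationary P $ i else 0)"
    using lim unfolding limit_matrix_def by blast+
  interpret N: prob_space N using gauss by (simp add: gaussian_matrix_def)
  have W [measurable]: "W \<in> borel_measurable N" using gauss by (simp add: gaussian_matrix_def)
  have Wij [measurable]: "(\<lambda>\<omega>. W \<omega> $ i $ j) \<in> borel_measurable N" for i j
    by (rule measurable_compose[OF W]) (intro borel_measurable_continuous_onI continuous_intros)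
  define Y where "Y = (\<lambda>\<omega>. \<Sum>i\<in>UNIV. \<Sum>j\<in>UNIV. A $ i $ j * W \<omega> $ i $ j)"
  have Y [measurable]: "Y \<in> borel_measurable N" unfolding Y_def by measurable
  obtain m v where v: "0 \<le> v" and law: "distr N borel Y = normal_law m v"
    using gauss unfolding gaussian_matrix_def Y_def by blast
  have sq: "integrable N (\<lambda>\<omega>. (W \<omega> $ i $ j)\<^sup>2)" for i j
  proof -
    let ?E = "(\<chi> k l. if k = i \<and> l = j then 1 else 0) :: real^'s^'s"
    obtain m v where "0 \<le> v" and
      "distr N borel (\<lambda>\<omega>. \<Sum>k\<in>UNIV. \<Sum>l\<in>UNIV. ?E $ k $ l * W \<omega> $ k $ l) = normal_law m v"
      using gauss unfolding gaussian_matrix_def by blast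
    moreover have "(\<Sum>k\<in>UNIV. \<Sum>l\<in>UNIV. ?E $ k $ l * W \<omega> $ k $ l) = W \<omega> $ i $ j" for \<omega>
    proof -
      have "(\<Sum>l\<in>UNIV. ?E $ k $ l * W \<omega> $ k $ l) = (if k = i then W \<omega> $ k $ j else 0)" for k
        by (cases "k = i") (auto simp: if_distrib[of "\<lambda>x. x * _"] cong: if_cong)
      then show ?thesis by simp
    qed
    ultimately have "integrable (distr N borel (\<lambda>\<omega>. W \<omega> $ i $ j)) (\<lambda>x. x\<^sup>2)"
      using normal_law_moments(2)[of v m] by simp
    then show ?thesis by (simp add: integrable_distr_eq)
  qed
  have int: "integrable N (\<lambda>\<omega>. W \<omega> $ i $ j)" for i j
    by (rule N.square_integrable_imp_integrable[OF _ sq]) simp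
  have ab: "norm (a * b) \<le> norm (a\<^sup>2 + b\<^sup>2)" for a b :: real
  proof -
    have "norm (a * b) \<le> 2 * \<bar>a\<bar> * \<bar>b\<bar>"
      using mult_right_mono[of 1 2 "\<bar>a\<bar> * \<bar>b\<bar>"] by (simp add: abs_mult mult.assoc)
    also have "\<dots> \<le> norm (a\<^sup>2 + b\<^sup>2)"
      using sum_squares_bound[of "\<bar>a\<bar>" "\<bar>b\<bar>"] by simp
    finally show ?thesis .
  qed
  have int2: "integrable N (\<lambda>\<omega>. W \<omega> $ i $ j * W \<omega> $ k $ l)" for i j k l
    by (rule Bochner_Integration.integrable_bound[of _ "\<lambda>\<omega>. (W \<omega> $ i $ j)\<^sup>2 + (W \<omega> $ k $ l)\<^sup>2"])
       (simp_all add: sq ab del: real_norm_def)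
  have "m = (\<integral>x. x \<partial>distr N borel Y)" using normal_law_moments(1)[OF v] law by simp
  also have "\<dots> = (\<integral>\<omega>. Y \<omega> \<partial>N)" by (simp add: integral_distr)
  also have "\<dots> = 0" unfolding Y_def by (simp add: int mean)
  finally have m: "m = 0" .
  have "v = (\<integral>x. x\<^sup>2 \<partial>distr N borel Y)" using normal_law_moments(3)[OF v, of m] law m by simp
  also have "\<dots> = (\<integral>\<omega>. (Y \<omega>)\<^sup>2 \<partial>N)" by (simp add: integral_distr)
  also have "\<dots> = (\<integral>\<omega>. (\<Sum>i\<in>UNIV. \<Sum>k\<in>UNIV. \<Sum>j\<in>UNIV. \<Sum>l\<in>UNIV.
      A $ i $ j * A $ k $ l * (W \<omega> $ i $ j * W \<omega> $ k $ l)) \<partial>N)"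
    unfolding Y_def power2_eq_square sum_product
    by (intro Bochner_Integration.integral_cong refl sum.cong) (simp only: mult_ac)
  also have "\<dots> = (\<Sum>i\<in>UNIV. \<Sum>k\<in>UNIV. \<Sum>j\<in>UNIV. \<Sum>l\<in>UNIV.
      A $ i $ j * A $ k $ l * (\<integral>\<omega>. W \<omega> $ i $ j * W \<omega> $ k $ l \<partial>N))"
    by (simp add: int2)
  also have "\<dots> = (\<Sum>i\<in>UNIV. \<Sum>k\<in>UNIV. \<Sum>j\<in>UNIV. \<Sum>l\<in>UNIV. A $ i $ j * A $ k $ l *
     (if i = k then P $ i $ j * ((if j = l then 1 else 0) - P $ i $ l) / stationary P $ i else 0))"
    using cov by (intro sum.cong refl) (simp add: covariance_def mean)
  also have "\<dots> = (\<Sum>i\<in>UNIV. \<Sum>k\<in>UNIV. if i = k then (\<Sum>j\<in>UNIV. \<Sum>l\<in>UNIV. A $ i $ j * A $ i $ l *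
     (P $ i $ j * ((if j = l then 1 else 0) - P $ i $ l) / stationary P $ i)) else 0)"
    by (intro sum.cong refl) auto
  also have "\<dots> = (\<Sum>i\<in>UNIV. \<Sum>j\<in>UNIV. \<Sum>l\<in>UNIV. A $ i $ j * A $ i $ l *
     (P $ i $ j * ((if j = l then 1 else 0) - P $ i $ l) / stationary P $ i))"
    by (simp only: sum.delta' finite UNIV_I if_True)
  also have "\<dots> = \<sigma>2"
    unfolding \<sigma>2_def
  proof (intro sum.cong refl)
    fix i
    have "(\<Sum>l\<in>UNIV. A $ i $ j * A $ i $ l * (P $ i $ j * ((if j = l then 1 else 0) - P $ i $ l)))
        = P $ i $ j * (A $ i $ j)\<^sup>2 - P $ i $ j * A $ i $ j * (\<Sum>l\<in>UNIV. P $ i $ l * A $ i $ l)" for j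
    proof -
      have "(\<Sum>l\<in>UNIV. A $ i $ j * A $ i $ l * (P $ i $ j * ((if j = l then 1 else 0) - P $ i $ l)))
        = (\<Sum>l\<in>UNIV. (if j = l then P $ i $ j * A $ i $ j * A $ i $ l else 0)
            - P $ i $ j * A $ i $ j * (P $ i $ l * A $ i $ l))"
        by (intro sum.cong) (auto simp: algebra_simps)
      then show ?thesis by (simp add: sum_subtractf sum_distrib_left power2_eq_square mult_ac)
    qed
    then have "(\<Sum>j\<in>UNIV. \<Sum>l\<in>UNIV. A $ i $ j * A $ i $ l * (P $ i $ j * ((if j = l then 1 else 0) - P $ i $ l)))
        = (\<Sum>j\<in>UNIV. P $ i $ j * (A $ i $ j)\<^sup>2) - (\<Sum>j\<in>UNIV. P $ i $ j * A $ i $ j)\<^sup>2"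
      by (simp add: sum_subtractf power2_eq_square flip: sum_distrib_right)
    then show "(\<Sum>j\<in>UNIV. \<Sum>l\<in>UNIV. A $ i $ j * A $ i $ l *
        (P $ i $ j * ((if j = l then 1 else 0) - P $ i $ l) / stationary P $ i))
      = ((\<Sum>j\<in>UNIV. P $ i $ j * (A $ i $ j)\<^sup>2) - (\<Sum>j\<in>UNIV. P $ i $ j * A $ i $ j)\<^sup>2) / stationary P $ i"
      by (simp flip: sum_divide_distrib)
  qed
  finally have "v = \<sigma>2" .
  with law v m show "distr N borel (\<lambda>\<omega>. \<Sum>i\<in>UNIV. \<Sum>j\<in>UNIV. A $ i $ j * W \<omega> $ i $ j) = normal_law 0 \<sigma>2"
    and "0 \<le> \<sigma>2" by (auto simp: Y_def)
qed

section \<open>Expectations along the trajectory\<close>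

definition depends_upto :: "nat \<Rightarrow> ((nat \<Rightarrow> 's) \<Rightarrow> 'b) \<Rightarrow> bool" where
  "depends_upto k F \<longleftrightarrow> (\<forall>x y. (\<forall>l\<le>k. x l = y l) \<longrightarrow> F x = F y)"

locale irreducible_chain = prob_space M
  for M :: "'a measure" and X :: "nat \<Rightarrow> 'a \<Rightarrow> 's::finite" and P :: "real^'s^'s" +
  assumes irr: "irreducible_stochastic P" and chain: "markov_chain M X P"
begin

lemma X_measurable [measurable]: "X m \<in> M \<rightarrow>\<^sub>M count_space UNIV"
  using chain by (simp add: markov_chain_def)

lemma P_nonneg: "0 \<le> P $ i $ j"
  using irr by (simp add: irreducible_stochastic_def stochastic_nonneg)

lemma P_row_sum: "(\<Sum>j\<in>UNIV. P $ i $ j) = 1"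
  using irr by (simp add: irreducible_stochastic_def stochastic_matrix_def)

definition traj :: "'a \<Rightarrow> nat \<Rightarrow> 's" where
  "traj \<omega> m = X m \<omega>"

definition cylinder :: "nat \<Rightarrow> (nat \<Rightarrow> 's) \<Rightarrow> 'a set" where
  "cylinder k a = {\<omega>\<in>space M. \<forall>l\<le>k. X l \<omega> = a l}"

abbreviation words :: "nat \<Rightarrow> (nat \<Rightarrow> 's) set" where
  "words k \<equiv> {..k} \<rightarrow>\<^sub>E UNIV"

lemma finite_words: "finite (words k)"
  by (intro finite_PiE) auto

lemma prob_cylinder_next:
  "prob (cylinder k a \<inter> {\<omega>\<in>space M. X (Suc k) \<omega> = j}) = prob (cylinder k a) * P $ a k $ j"
proof -
  have ev: "cylinder k a \<in> events" unfolding cylinder_def by measurable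
  have sub: "prob (cylinder k a \<inter> {\<omega>\<in>space M. X (Suc k) \<omega> = j}) \<le> prob (cylinder k a)"
    using ev by (intro finite_measure_mono) auto
  show ?thesis
  proof (cases "prob (cylinder k a) = 0")
    case True
    with sub have "prob (cylinder k a \<inter> {\<omega>\<in>space M. X (Suc k) \<omega> = j}) = 0"
      by (intro antisym) simp_all
    with True show ?thesis by simp
  next
    case False
    then have pos: "prob (cylinder k a) > 0" by (simp add: zero_less_measure_iff)
    let ?x = "a(Suc k := j)"
    have cyl: "{\<omega>\<in>space M. \<forall>l\<le>k. X l \<omega> = ?x l} = cylinder k a"
      by (auto simp: cylinder_def)
    have "{\<omega>\<in>space M. X (Suc k) \<omega> = ?x (Suc k) \<and> (\<forall>l\<le>k. X l \<omega> = ?x l)}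
        = cylinder k a \<inter> {\<omega>\<in>space M. X (Suc k) \<omega> = j}"
      by (auto simp: cylinder_def)
    moreover have "\<P>(\<omega> in M. X (Suc k) \<omega> = ?x (Suc k) \<bar> \<forall>l\<le>k. X l \<omega> = ?x l) = P $ ?x k $ ?x (Suc k)"
      using chain pos by (simp add: markov_chain_def cyl del: fun_upd_apply)
    ultimately show ?thesis
      using pos by (simp add: cond_prob_def cyl field_simps del: fun_upd_apply) (simp add: mult.commute)
  qed
qed

text \<open>A function of the first \<open>k + 2\<close> states takes finitely many values, on the cylinder
  sets.\<close>

lemma has_integral_next:
  fixes F :: "(nat \<Rightarrow> 's) \<Rightarrow> 's \<Rightarrow> 'b::{banach, second_countable_topology}"
  assumes F: "\<And>j. depends_upto k (\<lambda>x. F x j)"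
  shows "has_bochner_integral M (\<lambda>\<omega>. F (traj \<omega>) (X (Suc k) \<omega>))
    (\<Sum>a\<in>words k. prob (cylinder k a) *\<^sub>R (\<Sum>j\<in>UNIV. P $ a k $ j *\<^sub>R F a j))"
proof -
  let ?C = "\<lambda>a j. cylinder k a \<inter> {\<omega>\<in>space M. X (Suc k) \<omega> = j}"
  have ev: "?C a j \<in> events" for a j unfolding cylinder_def by measurable
  have eq: "F (traj \<omega>) (X (Suc k) \<omega>) = (\<Sum>a\<in>words k. \<Sum>j\<in>UNIV. indicator (?C a j) \<omega> *\<^sub>R F a j)"
    if \<omega>: "\<omega> \<in> space M" for \<omega>
  proof -
    let ?r = "restrict (traj \<omega>) {..k}"
    have "(\<Sum>j\<in>UNIV. indicator (?C a j) \<omega> *\<^sub>R F a j) = (if a = ?r then F a (X (Suc k) \<omega>) else 0)"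
      if "a \<in> words k" for a
    proof -
      have "\<omega> \<in> cylinder k a \<longleftrightarrow> a = ?r"
      proof -
        have "a = ?r \<longleftrightarrow> (\<forall>l\<in>{..k}. a l = ?r l)"
          using that PiE_ext[of a "{..k}" "\<lambda>_. UNIV" ?r] by auto
        then show ?thesis using \<omega> by (auto simp: cylinder_def traj_def)
      qed
      then have "indicator (?C a j) \<omega> *\<^sub>R F a j = (if j = X (Suc k) \<omega> then (if a = ?r then F a j else 0) else 0)" for j
        using \<omega> by (auto simp: indicator_def)
      then show ?thesis by simp
    qed
    then have "(\<Sum>a\<in>words k. \<Sum>j\<in>UNIV. indicator (?C a j) \<omega> *\<^sub>R F a j)
        = (\<Sum>a\<in>words k. if a = ?r then F a (X (Suc k) \<omega>) else 0)"
      by (intro sum.cong) auto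
    also have "\<dots> = F ?r (X (Suc k) \<omega>)"
      by (subst sum.delta[OF finite_words]) auto
    also have "\<dots> = F (traj \<omega>) (X (Suc k) \<omega>)"
      using F[unfolded depends_upto_def, rule_format, of ?r "traj \<omega>"] by simp
    finally show ?thesis by simp
  qed
  have "has_bochner_integral M
      (\<lambda>\<omega>. \<Sum>a\<in>words k. \<Sum>j\<in>UNIV. indicator (?C a j) \<omega> *\<^sub>R F a j)
      (\<Sum>a\<in>words k. \<Sum>j\<in>UNIV. prob (?C a j) *\<^sub>R F a j)"
    using ev by (intro has_bochner_integral_sum has_bochner_integral_indicator)
      (auto simp: emeasure_eq_measure)
  moreover have "has_bochner_integral M (\<lambda>\<omega>. F (traj \<omega>) (X (Suc k) \<omega>)) I \<longleftrightarrow>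
      has_bochner_integral M (\<lambda>\<omega>. \<Sum>a\<in>words k. \<Sum>j\<in>UNIV. indicator (?C a j) \<omega> *\<^sub>R F a j) I" for I
    by (intro has_bochner_integral_cong refl eq)
  ultimately have "has_bochner_integral M (\<lambda>\<omega>. F (traj \<omega>) (X (Suc k) \<omega>))
      (\<Sum>a\<in>words k. \<Sum>j\<in>UNIV. prob (?C a j) *\<^sub>R F a j)"
    by blast
  then show ?thesis
    by (simp add: prob_cylinder_next scaleR_sum_right)
qed

lemma integrable_traj:
  fixes F :: "(nat \<Rightarrow> 's) \<Rightarrow> 'b::{banach, second_countable_topology}"
  assumes "depends_upto k F"
  shows "integrable M (\<lambda>\<omega>. F (traj \<omega>))"
  by (rule integrable.intros[OF has_integral_next[of k "\<lambda>x j. F x"]]) (rule assms)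

lemma markov_property:
  fixes F :: "(nat \<Rightarrow> 's) \<Rightarrow> 's \<Rightarrow> 'b::{banach, second_countable_topology}"
  assumes F: "\<And>j. depends_upto k (\<lambda>x. F x j)"
  shows "expectation (\<lambda>\<omega>. F (traj \<omega>) (X (Suc k) \<omega>))
    = expectation (\<lambda>\<omega>. \<Sum>j\<in>UNIV. P $ X k \<omega> $ j *\<^sub>R F (traj \<omega>) j)"
proof -
  have "depends_upto k (\<lambda>x. \<Sum>j\<in>UNIV. P $ x k $ j *\<^sub>R F x j)"
    unfolding depends_upto_def
  proof (intro allI impI sum.cong refl)
    fix x y :: "nat \<Rightarrow> 's" and j assume xy: "\<forall>l\<le>k. x l = y l"
    then have "F x j = F y j" using F[of j] unfolding depends_upto_def by blast
    with xy show "P $ x k $ j *\<^sub>R F x j = P $ y k $ j *\<^sub>R F y j" by simp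
  qed
  then have "has_bochner_integral M (\<lambda>\<omega>. \<Sum>j\<in>UNIV. P $ traj \<omega> k $ j *\<^sub>R F (traj \<omega>) j)
      (\<Sum>a\<in>words k. prob (cylinder k a) *\<^sub>R
        (\<Sum>i\<in>UNIV. P $ a k $ i *\<^sub>R (\<Sum>j\<in>UNIV. P $ a k $ j *\<^sub>R F a j)))"
    by (rule has_integral_next)
  also have "(\<Sum>a\<in>words k. prob (cylinder k a) *\<^sub>R
        (\<Sum>i\<in>UNIV. P $ a k $ i *\<^sub>R (\<Sum>j\<in>UNIV. P $ a k $ j *\<^sub>R F a j)))
      = (\<Sum>a\<in>words k. prob (cylinder k a) *\<^sub>R (\<Sum>j\<in>UNIV. P $ a k $ j *\<^sub>R F a j))"
    by (simp only: scaleR_sum_left[symmetric] P_row_sum scaleR_one)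
  finally have "expectation (\<lambda>\<omega>. \<Sum>j\<in>UNIV. P $ traj \<omega> k $ j *\<^sub>R F (traj \<omega>) j)
      = (\<Sum>a\<in>words k. prob (cylinder k a) *\<^sub>R (\<Sum>j\<in>UNIV. P $ a k $ j *\<^sub>R F a j))"
    by (rule has_bochner_integral_integral_eq)
  with has_bochner_integral_integral_eq[OF has_integral_next[OF F]] show ?thesis
    by (simp add: traj_def)
qed

section \<open>Additive functionals with centred increments\<close>

definition additive_sum :: "('s \<Rightarrow> 's \<Rightarrow> real) \<Rightarrow> nat \<Rightarrow> 'a \<Rightarrow> real" where
  "additive_sum f n \<omega> = (\<Sum>m<n. f (X m \<omega>) (X (Suc m) \<omega>))"

definition word_sum :: "('s \<Rightarrow> 's \<Rightarrow> real) \<Rightarrow> nat \<Rightarrow> (nat \<Rightarrow> 's) \<Rightarrow> real" where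
  "word_sum f n x = (\<Sum>m<n. f (x m) (x (Suc m)))"

lemma additive_eq_word_sum: "additive_sum f n \<omega> = word_sum f n (traj \<omega>)"
  by (simp add: additive_sum_def word_sum_def traj_def)

lemma additive_Suc: "additive_sum f (Suc n) \<omega> = additive_sum f n \<omega> + f (X n \<omega>) (X (Suc n) \<omega>)"
  by (simp add: additive_sum_def)

lemma word_sum_cong: "(\<And>l. l \<le> n \<Longrightarrow> x l = y l) \<Longrightarrow> word_sum f n x = word_sum f n y"
  by (simp add: word_sum_def)

lemma depends_upto_word_sum: "depends_upto n (\<lambda>x. G (word_sum f n x) (x n))"
  unfolding depends_upto_def
proof (intro allI impI)
  fix x y :: "nat \<Rightarrow> 's" assume "\<forall>l\<le>n. x l = y l"
  then have "word_sum f n x = word_sum f n y" "x n = y n" by (auto intro: word_sum_cong)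
  then show "G (word_sum f n x) (x n) = G (word_sum f n y) (y n)" by (simp only:)
qed

lemma integrable_additive:
  fixes G :: "real \<Rightarrow> 's \<Rightarrow> 'b::{banach, second_countable_topology}"
  shows "integrable M (\<lambda>\<omega>. G (additive_sum f n \<omega>) (X n \<omega>))"
  using integrable_traj[OF depends_upto_word_sum[of n G f]]
  by (simp only: additive_eq_word_sum traj_def)

lemma additive_measurable [measurable]: "random_variable borel (additive_sum f n)"
  using borel_measurable_integrable[OF integrable_additive[of "\<lambda>s x. s" f n]] by simp

lemma markov_property_additive:
  fixes G :: "real \<Rightarrow> 's \<Rightarrow> 's \<Rightarrow> 'b::{banach, second_countable_topology}"
  shows "expectation (\<lambda>\<omega>. G (additive_sum f k \<omega>) (X k \<omega>) (X (Suc k) \<omega>))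
    = expectation (\<lambda>\<omega>. \<Sum>j\<in>UNIV. P $ X k \<omega> $ j *\<^sub>R G (additive_sum f k \<omega>) (X k \<omega>) j)"
  using markov_property[of k "\<lambda>x j. G (word_sum f k x) (x k) j", OF depends_upto_word_sum]
  by (simp only: additive_eq_word_sum traj_def)

lemma finite_family_bound: "\<exists>B\<ge>0. \<forall>i j. \<bar>f i j\<bar> \<le> B" for f :: "'s \<Rightarrow> 's \<Rightarrow> real"
proof (intro exI[of _ "\<Sum>i\<in>UNIV. \<Sum>j\<in>UNIV. \<bar>f i j\<bar>"] conjI allI)
  show "0 \<le> (\<Sum>i\<in>UNIV. \<Sum>j\<in>UNIV. \<bar>f i j\<bar>)" by (intro sum_nonneg) simp
  fix i j
  have "\<bar>f i j\<bar> \<le> (\<Sum>j\<in>UNIV. \<bar>f i j\<bar>)" by (rule member_le_sum) auto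
  also have "\<dots> \<le> (\<Sum>i\<in>UNIV. \<Sum>j\<in>UNIV. \<bar>f i j\<bar>)"
    by (rule member_le_sum[of i UNIV "\<lambda>i. \<Sum>j\<in>UNIV. \<bar>f i j\<bar>"]) (auto intro: sum_nonneg)
  finally show "\<bar>f i j\<bar> \<le> (\<Sum>i\<in>UNIV. \<Sum>j\<in>UNIV. \<bar>f i j\<bar>)" .
qed

context
  fixes f :: "'s \<Rightarrow> 's \<Rightarrow> real"
  assumes centred: "\<And>i. (\<Sum>j\<in>UNIV. P $ i $ j * f i j) = 0"
begin

text \<open>The increments are martingale differences, hence orthogonal.\<close>

lemma additive_second_moment:
  assumes B: "\<And>i j. \<bar>f i j\<bar> \<le> B"
  shows "expectation (\<lambda>\<omega>. (additive_sum f n \<omega>)\<^sup>2) \<le> n * B\<^sup>2"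
proof (induction n)
  case 0
  show ?case by (simp add: additive_sum_def)
next
  case (Suc n)
  let ?f = "\<lambda>\<omega>. f (X n \<omega>) (X (Suc n) \<omega>)"
  have f2: "(?f \<omega>)\<^sup>2 \<le> B\<^sup>2" for \<omega>
    using B[of "X n \<omega>" "X (Suc n) \<omega>"] by (simp add: abs_le_square_iff[symmetric])
  have int: "integrable M (\<lambda>\<omega>. G (additive_sum f n \<omega>) (X n \<omega>) (X (Suc n) \<omega>))" for G :: "_ \<Rightarrow> _ \<Rightarrow> _ \<Rightarrow> real"
    using integrable.intros[OF has_integral_next[of n "\<lambda>x j. G (word_sum f n x) (x n) j",
        OF depends_upto_word_sum]]
    by (simp only: additive_eq_word_sum traj_def)
  note int' = int[of "\<lambda>s i j. s\<^sup>2"] int[of "\<lambda>s i j. s * f i j"] int[of "\<lambda>s i j. (f i j)\<^sup>2"]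
  have "expectation (\<lambda>\<omega>. additive_sum f n \<omega> * ?f \<omega>)
      = expectation (\<lambda>\<omega>. \<Sum>j\<in>UNIV. P $ X n \<omega> $ j *\<^sub>R (additive_sum f n \<omega> * f (X n \<omega>) j))"
    by (rule markov_property_additive[of "\<lambda>s i j. s * f i j"])
  also have "\<dots> = 0"
    using centred by (simp add: mult.left_commute flip: sum_distrib_left)
  finally have cross: "expectation (\<lambda>\<omega>. additive_sum f n \<omega> * ?f \<omega>) = 0" .
  have "expectation (\<lambda>\<omega>. (additive_sum f (Suc n) \<omega>)\<^sup>2)
      = expectation (\<lambda>\<omega>. (additive_sum f n \<omega>)\<^sup>2 + 2 * (additive_sum f n \<omega> * ?f \<omega>) + (?f \<omega>)\<^sup>2)"
    by (simp add: additive_Suc power2_sum algebra_simps)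
  also have "\<dots> = expectation (\<lambda>\<omega>. (additive_sum f n \<omega>)\<^sup>2) + 2 * expectation (\<lambda>\<omega>. additive_sum f n \<omega> * ?f \<omega>)
      + expectation (\<lambda>\<omega>. (?f \<omega>)\<^sup>2)"
    using int' by simp
  also have "expectation (\<lambda>\<omega>. (?f \<omega>)\<^sup>2) \<le> expectation (\<lambda>\<omega>. B\<^sup>2)"
    using int'(3) f2 by (intro integral_mono) auto
  finally show ?case
    using Suc cross by (simp add: prob_space algebra_simps)
qed

lemma additive_bounded_in_prob: "bounded_in_prob (\<lambda>n \<omega>. additive_sum f n \<omega> / sqrt n)"
proof -
  obtain B where B: "\<And>i j. \<bar>f i j\<bar> \<le> B" using finite_family_bound[of f] by blast
  show ?thesis
  proof (rule bounded_in_prob_if_second_moment)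
    show "random_variable borel (\<lambda>\<omega>. additive_sum f n \<omega> / sqrt n)" for n by measurable
    show "integrable M (\<lambda>\<omega>. (additive_sum f n \<omega> / sqrt n)\<^sup>2)" for n
      by (rule integrable_additive[of "\<lambda>s i. (s / sqrt n)\<^sup>2"])
    show "expectation (\<lambda>\<omega>. (additive_sum f n \<omega> / sqrt n)\<^sup>2) \<le> B\<^sup>2" for n
      using additive_second_moment[OF B, of n] by (cases "n = 0") (simp_all add: power_divide field_simps)
  qed
qed

end

end

context irreducible_chain
begin

section \<open>The law of large numbers for occupation times\<close>

lemma stationary_positive: "0 < stationary P $ i"
  by (rule stationary_pos[OF irr stationary_is_stationary[OF irr]])

text \<open>The solution \<open>u\<close> of the Poisson equation turns the centred occupation time into a
  telescoping sum plus a sum of the martingale differences \<open>u (X (m + 1)) - (P u) (X m)\<close>.\<close>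

lemma poisson_decomposition:
  assumes c: "stationary P \<bullet> c = 0"
  defines "u \<equiv> R_stat P *v c"
  shows "(\<Sum>m<n. c $ X m \<omega>)
      = u $ X 0 \<omega> - u $ X n \<omega> + additive_sum (\<lambda>i j. u $ j - (P *v u) $ i) n \<omega>"
    and "(\<Sum>j\<in>UNIV. P $ i $ j * (u $ j - (P *v u) $ i)) = 0"
proof -
  have u: "c $ i = u $ i - (P *v u) $ i" for i
    using poisson_equation[OF irr c] by (simp add: u_def vec_eq_iff)
  show "(\<Sum>m<n. c $ X m \<omega>)
      = u $ X 0 \<omega> - u $ X n \<omega> + additive_sum (\<lambda>i j. u $ j - (P *v u) $ i) n \<omega>"
    by (induction n) (simp_all add: additive_sum_def u)
  have "(\<Sum>j\<in>UNIV. P $ i $ j * (u $ j - (P *v u) $ i))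
      = (P *v u) $ i - (\<Sum>j\<in>UNIV. P $ i $ j) * (P *v u) $ i"
    by (simp only: right_diff_distrib sum_subtractf sum_distrib_right) (simp add: matrix_vector_mult_def)
  then show "(\<Sum>j\<in>UNIV. P $ i $ j * (u $ j - (P *v u) $ i)) = 0"
    by (simp add: P_row_sum)
qed

lemma bounded_in_prob_state_function: "bounded_in_prob (\<lambda>n \<omega>. h (X 0 \<omega>) (X n \<omega>))"
  for h :: "'s \<Rightarrow> 's \<Rightarrow> real"
proof -
  obtain B where B: "0 \<le> B" "\<And>i j. \<bar>h i j\<bar> \<le> B" using finite_family_bound[of h] by blast
  have dep: "depends_upto n (\<lambda>x. G (h (x 0) (x n)))" for n and G :: "real \<Rightarrow> real"
    by (simp add: depends_upto_def)
  have int: "integrable M (\<lambda>\<omega>. G (h (X 0 \<omega>) (X n \<omega>)))" for n and G :: "real \<Rightarrow> real"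
    using integrable_traj[OF dep[of n G]] by (simp only: traj_def)
  show ?thesis
  proof (rule bounded_in_prob_if_second_moment)
    show "random_variable borel (\<lambda>\<omega>. h (X 0 \<omega>) (X n \<omega>))" for n
      using borel_measurable_integrable[OF int[of "\<lambda>x. x" n]] .
    show "integrable M (\<lambda>\<omega>. (h (X 0 \<omega>) (X n \<omega>))\<^sup>2)" for n
      by (rule int[of "\<lambda>x. x\<^sup>2"])
    then have "expectation (\<lambda>\<omega>. (h (X 0 \<omega>) (X n \<omega>))\<^sup>2) \<le> expectation (\<lambda>\<omega>. B\<^sup>2)" for n
      by (intro integral_mono) (use B in \<open>auto simp: abs_le_square_iff[symmetric]\<close>)
    then show "expectation (\<lambda>\<omega>. (h (X 0 \<omega>) (X n \<omega>))\<^sup>2) \<le> B\<^sup>2" for n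
      by (simp add: prob_space)
  qed
qed

lemma occupation_frequency_vanishes:
  "vanishes_in_prob (\<lambda>n \<omega>. additive_sum (\<lambda>a b. of_bool (a = i)) n \<omega> / n - stationary P $ i)"
proof -
  define c :: "real^'s" where "c = axis i 1 - (stationary P $ i) *\<^sub>R 1"
  have "stationary P \<bullet> c = 0"
    by (simp add: c_def inner_diff_right stationary_inner_1[OF irr] inner_axis)
  note dec = poisson_decomposition[OF this]
  define u where "u = R_stat P *v c"
  define f where "f = (\<lambda>i j. u $ j - (P *v u) $ i)"
  have centred: "(\<Sum>j\<in>UNIV. P $ k $ j * f k j) = 0" for k
    using dec(2) by (simp add: f_def u_def)
  have sum_c: "(\<Sum>m<n. c $ X m \<omega>)
      = additive_sum (\<lambda>a b. of_bool (a = i)) n \<omega> - n * stationary P $ i" for n \<omega>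
    by (simp add: c_def additive_sum_def sum_subtractf axis_def of_bool_def eq_commute)
  have decomp: "additive_sum (\<lambda>a b. of_bool (a = i)) n \<omega> / n - stationary P $ i
      = (u $ X 0 \<omega> - u $ X n \<omega>) * (1 / n) + additive_sum f n \<omega> / sqrt n * (1 / sqrt n)
        + (if n = 0 then - stationary P $ i else 0)" for n \<omega>
  proof (cases "n = 0")
    case True
    then show ?thesis by (simp add: additive_sum_def)
  next
    case False
    have "additive_sum (\<lambda>a b. of_bool (a = i)) n \<omega> - n * stationary P $ i
        = u $ X 0 \<omega> - u $ X n \<omega> + additive_sum f n \<omega>"
      using dec(1)[of \<omega> n] by (simp only: sum_c f_def u_def)
    moreover have "additive_sum f n \<omega> / sqrt n * (1 / sqrt n) = additive_sum f n \<omega> / n"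
      by simp
    ultimately show ?thesis using False by (simp add: field_simps)
  qed
  have "(\<lambda>n. 1 / real n) \<longlonglongrightarrow> 0" by (rule lim_1_over_n)
  moreover have "(\<lambda>n. 1 / sqrt n) \<longlonglongrightarrow> 0"
    by (intro tendsto_divide_0[OF tendsto_const] filterlim_at_top_imp_at_infinity
        filterlim_compose[OF sqrt_at_top filterlim_real_sequentially])
  moreover have "(\<lambda>n :: nat. if n = 0 then - stationary P $ i else 0) \<longlonglongrightarrow> 0"
    by (rule tendsto_eventually) (auto simp: eventually_sequentially intro!: exI[of _ 1])
  ultimately show ?thesis
    unfolding decomp
    by (intro vanishes_in_prob_add vanishes_in_prob_mult vanishes_in_prob_const
        additive_bounded_in_prob centred bounded_in_prob_state_function[of "\<lambda>a b. u $ a - u $ b"])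
qed

section \<open>The central limit theorem for centred additive functionals\<close>

text \<open>The transition operator tilted by \<open>iexp (\<theta> f)\<close> governs the characteristic function of an
  additive functional.\<close>

definition tilted :: "real \<Rightarrow> ('s \<Rightarrow> 's \<Rightarrow> real) \<Rightarrow> ('s \<Rightarrow> complex) \<Rightarrow> 's \<Rightarrow> complex" where
  "tilted \<theta> f w i = (\<Sum>j\<in>UNIV. P $ i $ j *\<^sub>R (iexp (\<theta> * f i j) * w j))"

lemma expectation_tilted:
  "expectation (\<lambda>\<omega>. iexp (\<theta> * additive_sum f (Suc k) \<omega>) * w (X (Suc k) \<omega>))
    = expectation (\<lambda>\<omega>. iexp (\<theta> * additive_sum f k \<omega>) * tilted \<theta> f w (X k \<omega>))"
proof -
  have "expectation (\<lambda>\<omega>. iexp (\<theta> * additive_sum f (Suc k) \<omega>) * w (X (Suc k) \<omega>))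
    = expectation (\<lambda>\<omega>. iexp (\<theta> * additive_sum f k \<omega>) *
        (iexp (\<theta> * f (X k \<omega>) (X (Suc k) \<omega>)) * w (X (Suc k) \<omega>)))"
    by (simp add: additive_Suc distrib_left exp_add mult.assoc)
  also have "\<dots> = expectation (\<lambda>\<omega>. \<Sum>j\<in>UNIV. P $ X k \<omega> $ j *\<^sub>R
      (iexp (\<theta> * additive_sum f k \<omega>) * (iexp (\<theta> * f (X k \<omega>) j) * w j)))"
    by (rule markov_property_additive[of "\<lambda>s i j. iexp (\<theta> * s) * (iexp (\<theta> * f i j) * w j)"])
  also have "\<dots> = expectation (\<lambda>\<omega>. iexp (\<theta> * additive_sum f k \<omega>) * tilted \<theta> f w (X k \<omega>))"
    by (simp add: tilted_def sum_distrib_left)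
  finally show ?thesis .
qed

lemma norm_expectation_iexp_le:
  assumes "\<And>i. norm (w i) \<le> B"
  shows "norm (expectation (\<lambda>\<omega>. iexp (\<theta> * additive_sum f n \<omega>) * w (X n \<omega>))) \<le> B"
proof -
  have "norm (expectation (\<lambda>\<omega>. iexp (\<theta> * additive_sum f n \<omega>) * w (X n \<omega>)))
      \<le> expectation (\<lambda>\<omega>. norm (iexp (\<theta> * additive_sum f n \<omega>) * w (X n \<omega>)))"
    by (rule integral_norm_bound)
  also have "\<dots> \<le> expectation (\<lambda>\<omega>. B)"
  proof (rule integral_mono)
    show "integrable M (\<lambda>\<omega>. norm (iexp (\<theta> * additive_sum f n \<omega>) * w (X n \<omega>)))"
      by (rule integrable_norm integrable_additive[of "\<lambda>s i. iexp (\<theta> * s) * w i"])+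
    show "norm (iexp (\<theta> * additive_sum f n \<omega>) * w (X n \<omega>)) \<le> B" for \<omega>
      using assms by (simp add: norm_mult del: of_real_mult)
  qed simp
  finally show ?thesis by (simp add: prob_space)
qed

context
  fixes f :: "'s \<Rightarrow> 's \<Rightarrow> real" and \<sigma>2 :: real
  assumes centred: "\<And>i. (\<Sum>j\<in>UNIV. P $ i $ j * f i j) = 0"
  defines "\<sigma>2 \<equiv> (\<Sum>i\<in>UNIV. stationary P $ i * (\<Sum>j\<in>UNIV. P $ i $ j * (f i j)\<^sup>2))"
begin

text \<open>Expand the tilted operator in \<open>\<theta>\<close>. The first-order term vanishes because \<open>f\<close> is centred. At
  second order the conditional variance \<open>v\<close> of a step depends on the state, and \<open>u\<close> is chosen to
  solve \<open>u - P u = v - \<sigma>2\<close>, which replaces \<open>v\<close> by its stationary mean.\<close>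

lemma tilted_approximate_eigenvector:
  obtains u :: "'s \<Rightarrow> real" and U C :: real where "\<And>i. \<bar>u i\<bar> \<le> U" "0 \<le> C"
    "\<And>\<theta> i. \<bar>\<theta>\<bar> \<le> 1 \<Longrightarrow>
      norm (tilted \<theta> f (\<lambda>j. 1 - \<theta>\<^sup>2 / 2 * u j) i
        - (1 - \<theta>\<^sup>2 * \<sigma>2 / 2) * (1 - \<theta>\<^sup>2 / 2 * u i)) \<le> C * \<bar>\<theta>\<bar> ^ 3"
proof -
  define v :: "'s \<Rightarrow> real" where "v = (\<lambda>i. \<Sum>j\<in>UNIV. P $ i $ j * (f i j)\<^sup>2)"
  define c :: "real^'s" where "c = (\<chi> i. v i) - \<sigma>2 *\<^sub>R 1"
  define u where "u = R_stat P *v c"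
  have c0: "stationary P \<bullet> c = 0"
    unfolding c_def inner_diff_right inner_scaleR_right stationary_inner_1[OF irr]
    by (simp add: \<sigma>2_def v_def inner_vec_def)
  have u: "u $ i - (\<Sum>j\<in>UNIV. P $ i $ j * u $ j) = v i - \<sigma>2" for i
    using poisson_equation[OF irr c0, folded u_def]
    by (simp add: c_def vec_eq_iff matrix_vector_mult_def)
  obtain B where B: "0 \<le> B" "\<And>i j. \<bar>f i j\<bar> \<le> B" using finite_family_bound[of f] by blast
  obtain U where U: "0 \<le> U" "\<And>i. \<bar>u $ i\<bar> \<le> U"
    using finite_family_bound[of "\<lambda>i j. u $ i"] by blast
  define C where "C = B ^ 3 + U * B + \<bar>\<sigma>2\<bar> * U"
  show thesis
  proof
    show "\<bar>u $ i\<bar> \<le> U" for i by (rule U(2))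
    show "0 \<le> C" using B(1) U(1) by (simp add: C_def)
    fix \<theta> :: real and i assume \<theta>: "\<bar>\<theta>\<bar> \<le> 1"
    define r where "r = (\<lambda>j. iexp (\<theta> * f i j) * (1 - \<theta>\<^sup>2 / 2 * u $ j)
      - (1 + \<i> * (\<theta> * f i j) - (\<theta> * f i j)\<^sup>2 / 2 - \<theta>\<^sup>2 / 2 * u $ j))"
    have r: "norm (r j) \<le> (B ^ 3 + U * B) * \<bar>\<theta>\<bar> ^ 3" for j
    proof -
      let ?x = "\<theta> * f i j"
      have x: "\<bar>?x\<bar> \<le> \<bar>\<theta>\<bar> * B" using B by (simp add: abs_mult mult_left_mono)
      have "norm (iexp ?x - (1 + \<i> * ?x - ?x\<^sup>2 / 2)) \<le> \<bar>?x\<bar> ^ 3 / 6"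
        using iexp_approx1[of ?x 2] by (simp add: eval_nat_numeral algebra_simps power2_eq_square)
      also have "\<dots> \<le> \<bar>?x\<bar> ^ 3" by simp
      also have "\<dots> \<le> (\<bar>\<theta>\<bar> * B) ^ 3" using x by (rule power_mono) simp
      finally have 1: "norm (iexp ?x - (1 + \<i> * ?x - ?x\<^sup>2 / 2)) \<le> B ^ 3 * \<bar>\<theta>\<bar> ^ 3"
        by (simp add: power_mult_distrib mult.commute)
      have "norm (iexp ?x - 1) \<le> \<bar>?x\<bar>" using iexp_approx1[of ?x 0] by simp
      then have "norm (complex_of_real (\<theta>\<^sup>2 / 2 * u $ j) * (iexp ?x - 1)) \<le> (\<theta>\<^sup>2 / 2 * U) * (\<bar>\<theta>\<bar> * B)"
        unfolding norm_mult norm_of_real using x U B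
        by (intro mult_mono) (auto simp: abs_mult intro!: mult_left_mono)
      also have "\<dots> = U * B * \<bar>\<theta>\<bar> ^ 3 / 2"
        by (simp add: power3_eq_cube power2_eq_square)
      also have "\<dots> \<le> U * B * \<bar>\<theta>\<bar> ^ 3" using U B by simp
      finally have 2: "norm (complex_of_real (\<theta>\<^sup>2 / 2 * u $ j) * (iexp ?x - 1)) \<le> U * B * \<bar>\<theta>\<bar> ^ 3" .
      have "r j = (iexp ?x - (1 + \<i> * ?x - ?x\<^sup>2 / 2)) - complex_of_real (\<theta>\<^sup>2 / 2 * u $ j) * (iexp ?x - 1)"
        by (simp add: r_def field_simps)
      then have "norm (r j) \<le> norm (iexp ?x - (1 + \<i> * ?x - ?x\<^sup>2 / 2))
          + norm (complex_of_real (\<theta>\<^sup>2 / 2 * u $ j) * (iexp ?x - 1))"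
        by (simp only: norm_triangle_ineq4)
      also have "\<dots> \<le> B ^ 3 * \<bar>\<theta>\<bar> ^ 3 + U * B * \<bar>\<theta>\<bar> ^ 3"
        by (rule add_mono[OF 1 2])
      finally show ?thesis by (simp add: algebra_simps)
    qed
    have "(\<Sum>j\<in>UNIV. P $ i $ j *\<^sub>R (1 + \<i> * (\<theta> * f i j) - (\<theta> * f i j)\<^sup>2 / 2 - \<theta>\<^sup>2 / 2 * u $ j))
        = complex_of_real (\<Sum>j\<in>UNIV. P $ i $ j)
          + \<i> * \<theta> * complex_of_real (\<Sum>j\<in>UNIV. P $ i $ j * f i j)
          - complex_of_real (\<theta>\<^sup>2 / 2) * complex_of_real (\<Sum>j\<in>UNIV. P $ i $ j * (f i j)\<^sup>2)
          - complex_of_real (\<theta>\<^sup>2 / 2) * complex_of_real (\<Sum>j\<in>UNIV. P $ i $ j * u $ j)"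
      unfolding of_real_sum sum_distrib_left sum.distrib[symmetric] sum_subtractf[symmetric]
      by (intro sum.cong refl) (simp add: scaleR_conv_of_real algebra_simps power_mult_distrib)
    also have "(\<Sum>j\<in>UNIV. P $ i $ j * u $ j) = u $ i - v i + \<sigma>2" using u[of i] by simp
    also have "(\<Sum>j\<in>UNIV. P $ i $ j * (f i j)\<^sup>2) = v i" by (simp add: v_def)
    also have "complex_of_real (\<Sum>j\<in>UNIV. P $ i $ j)
          + \<i> * \<theta> * complex_of_real (\<Sum>j\<in>UNIV. P $ i $ j * f i j)
          - complex_of_real (\<theta>\<^sup>2 / 2) * complex_of_real (v i)
          - complex_of_real (\<theta>\<^sup>2 / 2) * complex_of_real (u $ i - v i + \<sigma>2)
        = 1 - complex_of_real (\<theta>\<^sup>2 / 2) * (u $ i + \<sigma>2)"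
      unfolding P_row_sum centred by (simp add: field_simps)
    finally have main: "(\<Sum>j\<in>UNIV. P $ i $ j *\<^sub>R
          (1 + \<i> * (\<theta> * f i j) - (\<theta> * f i j)\<^sup>2 / 2 - \<theta>\<^sup>2 / 2 * u $ j))
        = 1 - complex_of_real (\<theta>\<^sup>2 / 2) * (u $ i + \<sigma>2)" .
    have expand: "tilted \<theta> f (\<lambda>j. 1 - \<theta>\<^sup>2 / 2 * u $ j) i
        = 1 - complex_of_real (\<theta>\<^sup>2 / 2) * (u $ i + \<sigma>2) + (\<Sum>j\<in>UNIV. P $ i $ j *\<^sub>R r j)"
      unfolding main[symmetric] tilted_def r_def
      by (simp add: scaleR_diff_right sum_subtractf)
    have "tilted \<theta> f (\<lambda>j. 1 - \<theta>\<^sup>2 / 2 * u $ j) i - (1 - \<theta>\<^sup>2 * \<sigma>2 / 2) * (1 - \<theta>\<^sup>2 / 2 * u $ i)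
        = (\<Sum>j\<in>UNIV. P $ i $ j *\<^sub>R r j) - complex_of_real (\<theta> ^ 4 * \<sigma>2 * u $ i / 4)"
      unfolding expand by (simp add: field_simps power4_eq_xxxx power2_eq_square)
    moreover have "norm (\<Sum>j\<in>UNIV. P $ i $ j *\<^sub>R r j) \<le> (B ^ 3 + U * B) * \<bar>\<theta>\<bar> ^ 3"
    proof -
      have "norm (\<Sum>j\<in>UNIV. P $ i $ j *\<^sub>R r j) \<le> (\<Sum>j\<in>UNIV. P $ i $ j * ((B ^ 3 + U * B) * \<bar>\<theta>\<bar> ^ 3))"
        using r P_nonneg by (intro sum_norm_le) (auto intro!: mult_left_mono)
      then show ?thesis by (simp add: P_row_sum flip: sum_distrib_right)
    qed
    moreover have "norm (complex_of_real (\<theta> ^ 4 * \<sigma>2 * u $ i / 4)) \<le> \<bar>\<sigma>2\<bar> * U * \<bar>\<theta>\<bar> ^ 3"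
    proof -
      have "\<bar>\<theta>\<bar> ^ 4 * \<bar>\<sigma>2\<bar> * \<bar>u $ i\<bar> / 4 \<le> \<bar>\<theta>\<bar> ^ 4 * \<bar>\<sigma>2\<bar> * \<bar>u $ i\<bar>" by simp
      also have "\<dots> \<le> \<bar>\<theta>\<bar> ^ 3 * \<bar>\<sigma>2\<bar> * U"
        using \<theta> U by (intro mult_mono power_decreasing) auto
      finally show ?thesis
        unfolding norm_of_real by (simp add: abs_mult power_abs mult_ac)
    qed
    ultimately show "norm (tilted \<theta> f (\<lambda>j. 1 - \<theta>\<^sup>2 / 2 * u $ j) i
        - (1 - \<theta>\<^sup>2 * \<sigma>2 / 2) * (1 - \<theta>\<^sup>2 / 2 * u $ i)) \<le> C * \<bar>\<theta>\<bar> ^ 3"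
      using norm_triangle_ineq4[of "\<Sum>j\<in>UNIV. P $ i $ j *\<^sub>R r j" "complex_of_real (\<theta> ^ 4 * \<sigma>2 * u $ i / 4)"]
      by (simp add: C_def distrib_right)
  qed
qed

text \<open>Each step multiplies \<open>E (exp (i \<theta> S) w(X))\<close>, for the approximate eigenvector \<open>w\<close>, by the
  approximate eigenvalue up to an error of order \<open>\<theta>\<^sup>3\<close>. These errors add up because the eigenvalue
  is at most one in modulus; replacing \<open>w\<close> by \<open>1\<close> at both ends costs \<open>O(\<theta>\<^sup>2)\<close>.\<close>

lemma characteristic_function_bound:
  obtains C where "\<And>\<theta> n. \<bar>\<theta>\<bar> \<le> 1 \<Longrightarrow> \<theta>\<^sup>2 * \<sigma>2 \<le> 4 \<Longrightarrow>
    norm (expectation (\<lambda>\<omega>. iexp (\<theta> * additive_sum f n \<omega>)) - (1 - \<theta>\<^sup>2 * \<sigma>2 / 2) ^ n)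
      \<le> C * (n * \<bar>\<theta>\<bar> ^ 3 + \<theta>\<^sup>2)"
proof -
  obtain u :: "'s \<Rightarrow> real" and U C where uU: "\<And>i. \<bar>u i\<bar> \<le> U" and C: "0 \<le> C"
    "\<And>\<theta> i. \<bar>\<theta>\<bar> \<le> 1 \<Longrightarrow> norm (tilted \<theta> f (\<lambda>j. 1 - \<theta>\<^sup>2 / 2 * u j) i
        - (1 - \<theta>\<^sup>2 * \<sigma>2 / 2) * (1 - \<theta>\<^sup>2 / 2 * u i)) \<le> C * \<bar>\<theta>\<bar> ^ 3"
    using tilted_approximate_eigenvector by blast
  have "0 \<le> U" using uU[of undefined] by simp
  show thesis
  proof
    fix \<theta> :: real and n :: nat assume \<theta>: "\<bar>\<theta>\<bar> \<le> 1" "\<theta>\<^sup>2 * \<sigma>2 \<le> 4"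
    define \<rho> where "\<rho> = 1 - \<theta>\<^sup>2 * \<sigma>2 / 2"
    define w :: "'s \<Rightarrow> complex" where "w = (\<lambda>j. 1 - \<theta>\<^sup>2 / 2 * u j)"
    define a where "a = (\<lambda>k. expectation (\<lambda>\<omega>. iexp (\<theta> * additive_sum f k \<omega>) * w (X k \<omega>)))"
    note int = integrable_additive[of "\<lambda>s i. iexp (\<theta> * s) * h i" for h]
    have "0 \<le> \<sigma>2"
      unfolding \<sigma>2_def
      by (intro sum_nonneg mult_nonneg_nonneg P_nonneg less_imp_le[OF stationary_positive]) simp
    then have "0 \<le> \<theta>\<^sup>2 * \<sigma>2" by simp
    with \<theta>(2) have \<rho>: "\<bar>\<rho>\<bar> \<le> 1" unfolding \<rho>_def abs_le_iff by linarith
    have step: "norm (a (Suc k) - \<rho> * a k) \<le> C * \<bar>\<theta>\<bar> ^ 3" for k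
    proof -
      have "a (Suc k) - \<rho> * a k
          = expectation (\<lambda>\<omega>. iexp (\<theta> * additive_sum f k \<omega>) * tilted \<theta> f w (X k \<omega>))
            - expectation (\<lambda>\<omega>. \<rho> * (iexp (\<theta> * additive_sum f k \<omega>) * w (X k \<omega>)))"
        unfolding a_def expectation_tilted by (simp only: integral_mult_right_zero)
      also have "\<dots> = expectation (\<lambda>\<omega>. iexp (\<theta> * additive_sum f k \<omega>) * tilted \<theta> f w (X k \<omega>)
            - \<rho> * (iexp (\<theta> * additive_sum f k \<omega>) * w (X k \<omega>)))"
        by (rule Bochner_Integration.integral_diff[symmetric]) (intro int integrable_mult_right)+
      also have "\<dots> = expectation (\<lambda>\<omega>. iexp (\<theta> * additive_sum f k \<omega>) *
            (tilted \<theta> f w (X k \<omega>) - \<rho> * w (X k \<omega>)))"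
        by (intro Bochner_Integration.integral_cong refl) (simp only: right_diff_distrib mult_ac)
      also have "norm \<dots> \<le> C * \<bar>\<theta>\<bar> ^ 3"
        using C(2)[OF \<theta>(1)]
        by (intro norm_expectation_iexp_le[of "\<lambda>i. tilted \<theta> f w i - \<rho> * w i"]) (simp add: w_def \<rho>_def)
      finally show ?thesis .
    qed
    have iter: "norm (a n - \<rho> ^ n * a 0) \<le> n * (C * \<bar>\<theta>\<bar> ^ 3)"
    proof (induction n)
      case 0
      show ?case by simp
    next
      case (Suc n)
      have "a (Suc n) - \<rho> ^ Suc n * a 0 = (a (Suc n) - \<rho> * a n) + \<rho> * (a n - \<rho> ^ n * a 0)"
        by (simp add: algebra_simps)
      then have "norm (a (Suc n) - \<rho> ^ Suc n * a 0)
          \<le> norm (a (Suc n) - \<rho> * a n) + norm (\<rho> * (a n - \<rho> ^ n * a 0))"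
        by (simp only: norm_triangle_ineq)
      also have "norm (\<rho> * (a n - \<rho> ^ n * a 0)) \<le> 1 * norm (a n - \<rho> ^ n * a 0)"
        unfolding norm_mult norm_of_real by (intro mult_right_mono \<rho>) simp
      finally show ?case using step[of n] Suc by (simp add: algebra_simps)
    qed
    have close: "norm (expectation (\<lambda>\<omega>. iexp (\<theta> * additive_sum f k \<omega>)) - a k) \<le> \<theta>\<^sup>2 * U" for k
    proof -
      have "expectation (\<lambda>\<omega>. iexp (\<theta> * additive_sum f k \<omega>)) - a k
          = expectation (\<lambda>\<omega>. iexp (\<theta> * additive_sum f k \<omega>) * 1) - a k" by simp
      also have "\<dots> = expectation (\<lambda>\<omega>. iexp (\<theta> * additive_sum f k \<omega>) * 1
          - iexp (\<theta> * additive_sum f k \<omega>) * w (X k \<omega>))"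
        unfolding a_def by (rule Bochner_Integration.integral_diff[symmetric]) (rule int)+
      also have "\<dots> = expectation (\<lambda>\<omega>. iexp (\<theta> * additive_sum f k \<omega>) * (1 - w (X k \<omega>)))"
        by (simp only: right_diff_distrib)
      also have "norm \<dots> \<le> \<theta>\<^sup>2 * U"
      proof (intro norm_expectation_iexp_le[of "\<lambda>i. 1 - w i"])
        fix i
        have "norm (1 - w i) = \<theta>\<^sup>2 / 2 * \<bar>u i\<bar>"
          unfolding w_def by (simp add: norm_mult norm_divide norm_power)
        also have "\<dots> \<le> \<theta>\<^sup>2 * U" using uU[of i] by (intro mult_mono) auto
        finally show "norm (1 - w i) \<le> \<theta>\<^sup>2 * U" .
      qed
      finally show ?thesis .
    qed
    have "norm (a 0 - 1) \<le> \<theta>\<^sup>2 * U"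
      using close[of 0] by (simp add: additive_sum_def norm_minus_commute prob_space)
    then have "norm (\<rho> ^ n * (a 0 - 1)) \<le> 1 * (\<theta>\<^sup>2 * U)"
      unfolding norm_mult norm_power norm_of_real power_abs
      by (rule mult_mono[OF power_le_one[OF abs_ge_zero \<rho>]]) simp_all
    moreover have "expectation (\<lambda>\<omega>. iexp (\<theta> * additive_sum f n \<omega>)) - \<rho> ^ n
        = (expectation (\<lambda>\<omega>. iexp (\<theta> * additive_sum f n \<omega>)) - a n) + (a n - \<rho> ^ n * a 0) + \<rho> ^ n * (a 0 - 1)"
      by (simp add: algebra_simps)
    ultimately have "norm (expectation (\<lambda>\<omega>. iexp (\<theta> * additive_sum f n \<omega>)) - \<rho> ^ n)
        \<le> \<theta>\<^sup>2 * U + n * (C * \<bar>\<theta>\<bar> ^ 3) + 1 * (\<theta>\<^sup>2 * U)"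
      using norm_triangle_le[OF add_mono[OF norm_triangle_le[OF add_mono[OF close[of n] iter]]]] by metis
    also have "\<dots> \<le> (C + 2 * U) * (n * \<bar>\<theta>\<bar> ^ 3 + \<theta>\<^sup>2)"
    proof -
      have "0 \<le> 2 * U * (n * \<bar>\<theta>\<bar> ^ 3)" "0 \<le> C * \<theta>\<^sup>2" using C(1) \<open>0 \<le> U\<close> by simp_all
      then show ?thesis by (simp add: algebra_simps)
    qed
    finally show "norm (expectation (\<lambda>\<omega>. iexp (\<theta> * additive_sum f n \<omega>)) - (1 - \<theta>\<^sup>2 * \<sigma>2 / 2) ^ n)
      \<le> (C + 2 * U) * (n * \<bar>\<theta>\<bar> ^ 3 + \<theta>\<^sup>2)"
      by (simp add: \<rho>_def)
  qed
qed

lemma additive_char_limit: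
  "(\<lambda>n. char (distr M borel (\<lambda>\<omega>. additive_sum f n \<omega> / sqrt n)) t) \<longlonglongrightarrow> exp (- (t\<^sup>2 * \<sigma>2) / 2)"
proof -
  obtain C where C: "\<And>\<theta> n. \<bar>\<theta>\<bar> \<le> 1 \<Longrightarrow> \<theta>\<^sup>2 * \<sigma>2 \<le> 4 \<Longrightarrow>
    norm (expectation (\<lambda>\<omega>. iexp (\<theta> * additive_sum f n \<omega>)) - (1 - \<theta>\<^sup>2 * \<sigma>2 / 2) ^ n)
      \<le> C * (n * \<bar>\<theta>\<bar> ^ 3 + \<theta>\<^sup>2)"
    using characteristic_function_bound by blast
  define \<theta> where "\<theta> = (\<lambda>n :: nat. t / sqrt n)"
  let ?\<phi> = "\<lambda>n. char (distr M borel (\<lambda>\<omega>. additive_sum f n \<omega> / sqrt n)) t"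
  have \<phi>: "?\<phi> n = expectation (\<lambda>\<omega>. iexp (\<theta> n * additive_sum f n \<omega>))" for n
    by (subst char_distr) (simp_all add: \<theta>_def)
  have lim\<theta>: "\<theta> \<longlonglongrightarrow> 0"
    unfolding \<theta>_def
    by (intro tendsto_divide_0[OF tendsto_const] filterlim_at_top_imp_at_infinity
        filterlim_compose[OF sqrt_at_top filterlim_real_sequentially])
  have sq: "(\<theta> n)\<^sup>2 = t\<^sup>2 / n" for n by (simp add: \<theta>_def power_divide)
  have "(\<lambda>n. C * (t\<^sup>2 * \<bar>\<theta> n\<bar> + (\<theta> n)\<^sup>2)) \<longlonglongrightarrow> C * (t\<^sup>2 * \<bar>0\<bar> + 0\<^sup>2)"
    by (intro tendsto_intros lim\<theta>)
  then have lim: "(\<lambda>n. C * (t\<^sup>2 * \<bar>\<theta> n\<bar> + (\<theta> n)\<^sup>2)) \<longlonglongrightarrow> 0" by simp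
  have "(\<lambda>n. (\<theta> n)\<^sup>2 * \<sigma>2) \<longlonglongrightarrow> 0\<^sup>2 * \<sigma>2" by (intro tendsto_intros lim\<theta>)
  then have "\<forall>\<^sub>F n in sequentially. (\<theta> n)\<^sup>2 * \<sigma>2 < 4" by (rule order_tendstoD) simp
  moreover have "\<forall>\<^sub>F n in sequentially. \<bar>\<theta> n\<bar> < 1"
    using tendstoD[OF lim\<theta>, of 1] by (simp add: dist_norm)
  ultimately have "\<forall>\<^sub>F n in sequentially.
      norm (?\<phi> n - (1 - (\<theta> n)\<^sup>2 * \<sigma>2 / 2) ^ n) \<le> C * (t\<^sup>2 * \<bar>\<theta> n\<bar> + (\<theta> n)\<^sup>2)"
    using eventually_gt_at_top[of 0]
  proof eventually_elim
    case (elim n)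
    have "n * \<bar>\<theta> n\<bar> ^ 3 = n * (\<theta> n)\<^sup>2 * \<bar>\<theta> n\<bar>"
      by (simp add: power3_eq_cube power2_eq_square)
    also have "\<dots> = t\<^sup>2 * \<bar>\<theta> n\<bar>" using elim(3) by (simp add: sq)
    finally show ?case using C[of "\<theta> n" n] elim by (simp add: \<phi>)
  qed
  then have "(\<lambda>n. ?\<phi> n - (1 - (\<theta> n)\<^sup>2 * \<sigma>2 / 2) ^ n) \<longlonglongrightarrow> 0"
    by (rule Lim_null_comparison[OF _ lim])
  moreover have "(\<lambda>n. (1 - (\<theta> n)\<^sup>2 * \<sigma>2 / 2) ^ n) \<longlonglongrightarrow> exp (- (t\<^sup>2 * \<sigma>2) / 2)"
  proof -
    have "1 - (\<theta> n)\<^sup>2 * \<sigma>2 / 2 = 1 + (- (t\<^sup>2 * \<sigma>2) / 2) / n" for n by (simp add: sq)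
    then show ?thesis by (simp only: tendsto_exp_limit_sequentially)
  qed
  then have "(\<lambda>n. complex_of_real ((1 - (\<theta> n)\<^sup>2 * \<sigma>2 / 2) ^ n)) \<longlonglongrightarrow> complex_of_real (exp (- (t\<^sup>2 * \<sigma>2) / 2))"
    by (rule tendsto_of_real)
  ultimately have "(\<lambda>n. (?\<phi> n - (1 - (\<theta> n)\<^sup>2 * \<sigma>2 / 2) ^ n)
      + complex_of_real ((1 - (\<theta> n)\<^sup>2 * \<sigma>2 / 2) ^ n)) \<longlonglongrightarrow> 0 + complex_of_real (exp (- (t\<^sup>2 * \<sigma>2) / 2))"
    by (rule tendsto_add)
  moreover have "(?\<phi> n - (1 - (\<theta> n)\<^sup>2 * \<sigma>2 / 2) ^ n)
      + complex_of_real ((1 - (\<theta> n)\<^sup>2 * \<sigma>2 / 2) ^ n) = ?\<phi> n" for n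
    by (simp only: of_real_power of_real_diff of_real_1 of_real_divide of_real_mult of_real_numeral
        diff_add_cancel)
  ultimately show ?thesis by (simp only: add_0)
qed

end

end

section \<open>The empirical transition matrix\<close>

context irreducible_chain
begin

lemma transition_count_eq:
  "real (transition_count X n \<omega> i j) = additive_sum (\<lambda>a b. of_bool (a = i \<and> b = j)) n \<omega>"
proof -
  have "{m. m < n \<and> X m \<omega> = i \<and> X (Suc m) \<omega> = j} = {..<n} \<inter> {m. X m \<omega> = i \<and> X (Suc m) \<omega> = j}"
    by auto
  then show ?thesis by (simp add: transition_count_def additive_sum_def)
qed

lemma visit_count_eq: "real (visit_count X n \<omega> i) = additive_sum (\<lambda>a b. of_bool (a = i)) n \<omega>"
proof -
  have "real (visit_count X n \<omega> i)
      = (\<Sum>m<n. \<Sum>j\<in>UNIV. of_bool (X m \<omega> = i \<and> X (Suc m) \<omega> = j))"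
    unfolding visit_count_def of_nat_sum transition_count_eq additive_sum_def by (rule sum.swap)
  also have "\<dots> = (\<Sum>m<n. of_bool (X m \<omega> = i))"
  proof (intro sum.cong refl)
    show "(\<Sum>j\<in>UNIV. of_bool (X m \<omega> = i \<and> X (Suc m) \<omega> = j)) = (of_bool (X m \<omega> = i) :: real)" for m
      by (cases "X m \<omega> = i") (simp_all add: of_bool_def)
  qed
  finally show ?thesis by (simp only: additive_sum_def)
qed

lemma P_hat_entry:
  "P_hat X n \<omega> $ i $ j = additive_sum (\<lambda>a b. of_bool (a = i \<and> b = j)) n \<omega>
    / additive_sum (\<lambda>a b. of_bool (a = i)) n \<omega>"
  by (simp add: P_hat_def flip: transition_count_eq visit_count_eq)

lemma P_hat_measurable [measurable]: "random_variable borel (\<lambda>\<omega>. P_hat X n \<omega> $ i $ j)"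
  unfolding P_hat_entry by measurable

text \<open>Near \<open>P\<close>, each row of the empirical matrix has a positive entry, so its state has been
  visited and the row sums to one.\<close>

lemma P_hat_irreducible_near:
  obtains \<delta> where "\<delta> > 0"
    "\<And>n \<omega>. (\<And>i j. \<bar>P_hat X n \<omega> $ i $ j - P $ i $ j\<bar> < \<delta>) \<Longrightarrow> irreducible_stochastic (P_hat X n \<omega>)"
proof -
  obtain \<delta> where \<delta>: "\<delta> > 0"
    "\<And>Q i j. (\<And>i j. \<bar>Q $ i $ j - P $ i $ j\<bar> < \<delta>) \<Longrightarrow> 0 < P $ i $ j \<Longrightarrow> 0 < Q $ i $ j"
    using irreducible_near[OF irr] by blast
  show thesis
  proof
    fix n \<omega> assume near: "\<And>i j. \<bar>P_hat X n \<omega> $ i $ j - P $ i $ j\<bar> < \<delta>"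
    have pos: "0 < P_hat X n \<omega> $ i $ j" if "0 < P $ i $ j" for i j
      using \<delta>(2)[of "P_hat X n \<omega>", OF near that] .
    have nz: "visit_count X n \<omega> i \<noteq> 0" for i
    proof -
      have "\<exists>j. 0 < P $ i $ j"
      proof (rule ccontr)
        assume "\<not> ?thesis"
        then have "(\<Sum>j\<in>UNIV. P $ i $ j) \<le> 0" by (intro sum_nonpos) (simp add: not_less)
        then show False by (simp add: P_row_sum)
      qed
      then obtain j where "0 < P_hat X n \<omega> $ i $ j" using pos by blast
      then show ?thesis by (simp add: P_hat_def split: if_splits)
    qed
    have "(\<Sum>j\<in>UNIV. P_hat X n \<omega> $ i $ j) = 1" for i
    proof -
      have "(\<Sum>j\<in>UNIV. P_hat X n \<omega> $ i $ j)
          = (\<Sum>j\<in>UNIV. real (transition_count X n \<omega> i j)) / real (visit_count X n \<omega> i)"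
        using nz[of i] by (simp add: P_hat_def sum_divide_distrib)
      also have "(\<Sum>j\<in>UNIV. real (transition_count X n \<omega> i j)) = real (visit_count X n \<omega> i)"
        by (simp only: visit_count_def of_nat_sum)
      finally show ?thesis using nz by simp
    qed
    moreover have "0 \<le> P_hat X n \<omega> $ i $ j" for i j by (simp add: P_hat_def)
    ultimately have "stochastic_matrix (P_hat X n \<omega>)" by (simp add: stochastic_matrix_def)
    then show "irreducible_stochastic (P_hat X n \<omega>)"
      by (rule irreducible_if_support_superset[OF irr]) (rule pos)
  qed (rule \<delta>(1))
qed

text \<open>Summed along the trajectory this gives \<open>N_ij - p_ij N_i\<close>, the numerator of the estimation
  error in the entry \<open>(i, j)\<close>.\<close>

definition deviation :: "'s \<Rightarrow> 's \<Rightarrow> 's \<Rightarrow> 's \<Rightarrow> real" where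
  "deviation i j a b = of_bool (a = i) * (of_bool (b = j) - P $ i $ j)"

lemma deviation_centred: "(\<Sum>b\<in>UNIV. P $ a $ b * deviation i j a b) = 0"
proof -
  have "(\<Sum>b\<in>UNIV. P $ a $ b * (of_bool (b = j) - P $ a $ j))
      = (\<Sum>b\<in>UNIV. P $ a $ b * of_bool (b = j)) - (\<Sum>b\<in>UNIV. P $ a $ b) * P $ a $ j"
    by (simp only: right_diff_distrib sum_subtractf sum_distrib_right)
  also have "\<dots> = 0"
    by (simp add: P_row_sum of_bool_def if_distrib[of "\<lambda>x. _ * x"] cong: if_cong)
  finally show ?thesis by (cases "a = i") (simp_all add: deviation_def)
qed

lemma additive_deviation: "additive_sum (deviation i j) n \<omega>
    = additive_sum (\<lambda>a b. of_bool (a = i \<and> b = j)) n \<omega> - P $ i $ j * additive_sum (\<lambda>a b. of_bool (a = i)) n \<omega>"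
  unfolding additive_sum_def deviation_def sum_distrib_left sum_subtractf[symmetric]
  by (intro sum.cong refl) auto

lemma deviation_bounded: "bounded_in_prob (\<lambda>n \<omega>. additive_sum (deviation i j) n \<omega> / sqrt n)"
  by (rule additive_bounded_in_prob) (rule deviation_centred)

text \<open>As long as state \<open>i\<close> has been visited, the estimation error is the deviation divided by
  the occupation time, and the latter is close to \<open>n\<close> times the stationary probability.\<close>

lemma P_hat_linearization:
  "vanishes_in_prob (\<lambda>n \<omega>. sqrt n * (P_hat X n \<omega> $ i $ j - P $ i $ j)
    - additive_sum (deviation i j) n \<omega> / sqrt n / stationary P $ i)"
proof (rule vanishes_in_prob_if_small_multiple[OF occupation_frequency_vanishes[of i] deviation_bounded[of i j]])
  show "random_variable borel (\<lambda>\<omega>. sqrt n * (P_hat X n \<omega> $ i $ j - P $ i $ j)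
    - additive_sum (deviation i j) n \<omega> / sqrt n / stationary P $ i)" for n
    by measurable
  fix \<epsilon> :: real assume "\<epsilon> > 0"
  have pos: "0 < stationary P $ i" by (rule stationary_positive)
  then have "isCont inverse (stationary P $ i)" by (intro continuous_intros) simp
  then obtain \<delta> where \<delta>: "\<delta> > 0" "\<And>x. \<bar>x - stationary P $ i\<bar> < \<delta> \<Longrightarrow>
      \<bar>inverse x - inverse (stationary P $ i)\<bar> < \<epsilon>"
    using \<open>\<epsilon> > 0\<close> unfolding continuous_at_eps_delta by (auto simp: dist_norm)
  show "\<exists>\<delta>>0. \<forall>n. \<forall>\<omega>\<in>space M.
      \<bar>additive_sum (\<lambda>a b. of_bool (a = i)) n \<omega> / n - stationary P $ i\<bar> < \<delta> \<longrightarrow>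
      \<bar>sqrt n * (P_hat X n \<omega> $ i $ j - P $ i $ j) - additive_sum (deviation i j) n \<omega> / sqrt n / stationary P $ i\<bar>
      \<le> \<epsilon> * \<bar>additive_sum (deviation i j) n \<omega> / sqrt n\<bar>"
  proof (intro exI[of _ "min \<delta> (stationary P $ i)"] conjI allI ballI impI)
    show "0 < min \<delta> (stationary P $ i)" using \<delta>(1) pos by simp
    fix n \<omega>
    let ?N = "additive_sum (\<lambda>a b. of_bool (a = i)) n \<omega>"
    let ?V = "additive_sum (deviation i j) n \<omega> / sqrt n"
    assume near: "\<bar>?N / n - stationary P $ i\<bar> < min \<delta> (stationary P $ i)"
    have "?N / n \<noteq> 0"
    proof
      assume "?N / n = 0"
      with near pos show False by simp
    qed
    then have nz: "?N \<noteq> 0" "n \<noteq> 0" by auto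
    have "sqrt n * (P_hat X n \<omega> $ i $ j - P $ i $ j) = inverse (?N / n) * ?V"
    proof -
      have "P_hat X n \<omega> $ i $ j - P $ i $ j = additive_sum (deviation i j) n \<omega> / ?N"
        using nz by (simp add: P_hat_entry additive_deviation field_simps)
      moreover have "real n / sqrt n = sqrt n" using nz by (simp add: real_div_sqrt)
      moreover have "inverse (?N / n) * ?V = real n / sqrt n * (additive_sum (deviation i j) n \<omega> / ?N)"
        by (simp add: divide_inverse mult_ac)
      ultimately show ?thesis by (simp only:)
    qed
    then have "sqrt n * (P_hat X n \<omega> $ i $ j - P $ i $ j) - ?V / stationary P $ i
        = (inverse (?N / n) - inverse (stationary P $ i)) * ?V"
      by (simp only: left_diff_distrib divide_inverse[of ?V "stationary P $ i"] mult.commute[of ?V])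
    then have "\<bar>sqrt n * (P_hat X n \<omega> $ i $ j - P $ i $ j) - ?V / stationary P $ i\<bar>
        = \<bar>inverse (?N / n) - inverse (stationary P $ i)\<bar> * \<bar>?V\<bar>"
      by (simp only: abs_mult)
    also have "\<dots> \<le> \<epsilon> * \<bar>?V\<bar>"
      using \<delta>(2)[of "?N / n"] near by (intro mult_right_mono) auto
    finally show "\<bar>sqrt n * (P_hat X n \<omega> $ i $ j - P $ i $ j) - ?V / stationary P $ i\<bar> \<le> \<epsilon> * \<bar>?V\<bar>" .
  qed
qed

lemma P_hat_scaled_error_bounded:
  "bounded_in_prob (\<lambda>n \<omega>. sqrt n * (P_hat X n \<omega> $ i $ j - P $ i $ j))"
  using bounded_in_prob_add[OF vanishes_in_prob_imp_bounded[OF P_hat_linearization[of i j]]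
      bounded_in_prob_cmult[OF deviation_bounded[of i j], of "1 / stationary P $ i"]]
  by simp

lemma P_hat_consistent: "vanishes_in_prob (\<lambda>n \<omega>. P_hat X n \<omega> $ i $ j - P $ i $ j)"
proof (rule vanishes_in_prob_if_small_multiple[OF _ P_hat_scaled_error_bounded[of i j]])
  \<comment> \<open>The value at \<open>n = 0\<close> only has to be kept away from zero.\<close>
  let ?d = "\<lambda>n. if n = 0 then 1 else 1 / sqrt (real n)"
  have "(\<lambda>n. 1 / sqrt (real n)) \<longlonglongrightarrow> 0"
    by (intro tendsto_divide_0[OF tendsto_const] filterlim_at_top_imp_at_infinity
        filterlim_compose[OF sqrt_at_top filterlim_real_sequentially])
  then have "?d \<longlonglongrightarrow> 0"
    by (rule Lim_transform_eventually) (auto simp: eventually_sequentially intro!: exI[of _ 1])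
  then show "vanishes_in_prob (\<lambda>n \<omega>. ?d n)" by (rule vanishes_in_prob_const)
  show "random_variable borel (\<lambda>\<omega>. P_hat X n \<omega> $ i $ j - P $ i $ j)" for n by measurable
  fix \<epsilon> :: real assume "\<epsilon> > 0"
  have "\<bar>P_hat X n \<omega> $ i $ j - P $ i $ j\<bar> \<le> \<epsilon> * \<bar>sqrt n * (P_hat X n \<omega> $ i $ j - P $ i $ j)\<bar>"
    if d: "\<bar>?d n\<bar> < min \<epsilon> 1" for n \<omega>
  proof -
    have n: "n \<noteq> 0" using d by (auto split: if_splits)
    then have "1 \<le> \<epsilon> * sqrt n" using d by (simp add: field_simps)
    then have "1 * \<bar>P_hat X n \<omega> $ i $ j - P $ i $ j\<bar> \<le> \<epsilon> * sqrt n * \<bar>P_hat X n \<omega> $ i $ j - P $ i $ j\<bar>"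
      by (intro mult_right_mono) auto
    then show ?thesis by (simp add: abs_mult mult.assoc)
  qed
  then show "\<exists>\<delta>>0. \<forall>n. \<forall>\<omega>\<in>space M. \<bar>?d n\<bar> < \<delta> \<longrightarrow>
      \<bar>P_hat X n \<omega> $ i $ j - P $ i $ j\<bar> \<le> \<epsilon> * \<bar>sqrt n * (P_hat X n \<omega> $ i $ j - P $ i $ j)\<bar>"
    using \<open>\<epsilon> > 0\<close> by (intro exI[of _ "min \<epsilon> 1"]) auto
qed

end

section \<open>The delta method\<close>

lemma linear_matrix_functional:
  fixes L :: "real^'s::finite^'s \<Rightarrow> real"
  assumes "linear L"
  obtains A :: "real^'s^'s" where "\<And>H. L H = (\<Sum>i\<in>UNIV. \<Sum>j\<in>UNIV. A $ i $ j * H $ i $ j)"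
proof
  fix H :: "real^'s^'s"
  let ?E = "\<lambda>i j. axis i (axis j 1) :: real^'s^'s"
  have "(\<Sum>i\<in>UNIV. \<Sum>j\<in>UNIV. H $ i $ j *\<^sub>R ?E i j) = H"
  proof -
    have "(\<Sum>i\<in>UNIV. \<Sum>j\<in>UNIV. H $ i $ j *\<^sub>R ?E i j) $ k $ l = H $ k $ l" for k l
    proof -
      have "(\<Sum>j\<in>UNIV. H $ i $ j * ?E i j $ k $ l) = (if i = k then H $ i $ l else 0)" for i
        by (cases "i = k") (simp_all add: axis_def if_distrib[of "\<lambda>x. _ * x"] cong: if_cong)
      then show ?thesis by simp
    qed
    then show ?thesis by (simp add: vec_eq_iff)
  qed
  then have "L H = L (\<Sum>i\<in>UNIV. \<Sum>j\<in>UNIV. H $ i $ j *\<^sub>R ?E i j)" by simp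
  also have "\<dots> = (\<Sum>i\<in>UNIV. \<Sum>j\<in>UNIV. H $ i $ j * L (?E i j))"
    using assms by (simp add: linear_sum linear_scale)
  finally show "L H = (\<Sum>i\<in>UNIV. \<Sum>j\<in>UNIV. (\<chi> i j. L (?E i j)) $ i $ j * H $ i $ j)"
    by (simp add: mult.commute)
qed

lemma norm_matrix_le_sum: "norm (H :: real^'s::finite^'s) \<le> (\<Sum>i\<in>UNIV. \<Sum>j\<in>UNIV. \<bar>H $ i $ j\<bar>)"
proof -
  have "norm H \<le> (\<Sum>i\<in>UNIV. norm (H $ i))"
    unfolding norm_vec_def by (rule L2_set_le_sum) simp
  also have "\<dots> \<le> (\<Sum>i\<in>UNIV. \<Sum>j\<in>UNIV. \<bar>H $ i $ j\<bar>)"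
    by (intro sum_mono norm_le_l1_cart)
  finally show ?thesis .
qed

context irreducible_chain
begin

text \<open>Where the estimation error is small, the empirical matrix is irreducible and stochastic, so
  \<open>Z\<close> is the value of \<open>f\<close> there, and the remainder in the definition of the derivative is a small
  multiple of the error, which is of order \<open>1 / sqrt n\<close>.\<close>

lemma plug_in_linearization:
  assumes f: "(f has_derivative L) (at P within irreducibles)" and Z: "plug_in M X f Z"
    and A: "\<And>H. L H = (\<Sum>i\<in>UNIV. \<Sum>j\<in>UNIV. A $ i $ j * H $ i $ j)"
  shows "vanishes_in_prob (\<lambda>n \<omega>. sqrt n * (Z n \<omega> - f P)
    - (\<Sum>i\<in>UNIV. \<Sum>j\<in>UNIV. A $ i $ j * (sqrt n * (P_hat X n \<omega> $ i $ j - P $ i $ j))))"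
proof (rule vanishes_in_prob_if_small_multiple)
  let ?e = "\<lambda>n \<omega> i j. P_hat X n \<omega> $ i $ j - P $ i $ j"
  have Zm [measurable]: "random_variable borel (Z n)" for n using Z by (simp add: plug_in_def)
  show "vanishes_in_prob (\<lambda>n \<omega>. \<Sum>i\<in>UNIV. \<Sum>j\<in>UNIV. \<bar>?e n \<omega> i j\<bar>)"
    by (intro vanishes_in_prob_sum vanishes_in_prob_abs P_hat_consistent) simp_all
  show "bounded_in_prob (\<lambda>n \<omega>. \<Sum>i\<in>UNIV. \<Sum>j\<in>UNIV. \<bar>sqrt n * ?e n \<omega> i j\<bar>)"
    by (intro bounded_in_prob_sum bounded_in_prob_abs P_hat_scaled_error_bounded) simp_all
  show "random_variable borel (\<lambda>\<omega>. sqrt n * (Z n \<omega> - f P)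
    - (\<Sum>i\<in>UNIV. \<Sum>j\<in>UNIV. A $ i $ j * (sqrt n * ?e n \<omega> i j)))" for n
    by measurable
  fix \<epsilon> :: real assume "\<epsilon> > 0"
  obtain \<delta>1 where \<delta>1: "\<delta>1 > 0" "\<And>n \<omega>. (\<And>i j. \<bar>?e n \<omega> i j\<bar> < \<delta>1) \<Longrightarrow> irreducible_stochastic (P_hat X n \<omega>)"
    using P_hat_irreducible_near by blast
  obtain \<delta>2 where \<delta>2: "\<delta>2 > 0" "\<And>Q. irreducible_stochastic Q \<Longrightarrow> norm (Q - P) < \<delta>2 \<Longrightarrow>
      norm (f Q - f P - L (Q - P)) \<le> \<epsilon> * norm (Q - P)"
    using f \<open>\<epsilon> > 0\<close> unfolding has_derivative_within_alt by (metis mem_Collect_eq)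
  have bound: "\<bar>sqrt n * (Z n \<omega> - f P) - (\<Sum>i\<in>UNIV. \<Sum>j\<in>UNIV. A $ i $ j * (sqrt n * ?e n \<omega> i j))\<bar>
      \<le> \<epsilon> * \<bar>\<Sum>i\<in>UNIV. \<Sum>j\<in>UNIV. \<bar>sqrt n * ?e n \<omega> i j\<bar>\<bar>"
    if \<omega>: "\<omega> \<in> space M" and near: "\<bar>\<Sum>i\<in>UNIV. \<Sum>j\<in>UNIV. \<bar>?e n \<omega> i j\<bar>\<bar> < min \<delta>1 \<delta>2" for n \<omega>
  proof -
    let ?Q = "P_hat X n \<omega>"
    let ?D = "\<Sum>i\<in>UNIV. \<Sum>j\<in>UNIV. \<bar>?e n \<omega> i j\<bar>"
    have D: "?D < min \<delta>1 \<delta>2" using near by linarith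
    have "\<bar>?e n \<omega> i j\<bar> \<le> ?D" for i j
    proof -
      have "\<bar>?e n \<omega> i j\<bar> \<le> (\<Sum>j\<in>UNIV. \<bar>?e n \<omega> i j\<bar>)" by (rule member_le_sum) auto
      also have "\<dots> \<le> ?D"
        by (rule member_le_sum[of i UNIV "\<lambda>i. \<Sum>j\<in>UNIV. \<bar>?e n \<omega> i j\<bar>"]) (auto intro: sum_nonneg)
      finally show ?thesis .
    qed
    then have "\<bar>?e n \<omega> i j\<bar> < \<delta>1" for i j using D by (meson le_less_trans min_less_iff_conj)
    then have Q: "irreducible_stochastic ?Q" by (rule \<delta>1(2))
    have nD: "norm (?Q - P) \<le> ?D" using norm_matrix_le_sum[of "?Q - P"] by simp
    have "\<bar>f ?Q - f P - L (?Q - P)\<bar> \<le> \<epsilon> * norm (?Q - P)"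
      using \<delta>2(2)[OF Q] nD D by simp
    also have "\<dots> \<le> \<epsilon> * ?D" using nD \<open>\<epsilon> > 0\<close> by simp
    finally have "sqrt n * \<bar>f ?Q - f P - L (?Q - P)\<bar> \<le> sqrt n * (\<epsilon> * ?D)"
      by (rule mult_left_mono) simp
    moreover have "sqrt n * (Z n \<omega> - f P) - (\<Sum>i\<in>UNIV. \<Sum>j\<in>UNIV. A $ i $ j * (sqrt n * ?e n \<omega> i j))
        = sqrt n * (f ?Q - f P - L (?Q - P))"
    proof -
      have "Z n \<omega> = f ?Q" using Z Q \<omega> by (simp add: plug_in_def)
      moreover have "(\<Sum>i\<in>UNIV. \<Sum>j\<in>UNIV. A $ i $ j * (sqrt n * ?e n \<omega> i j)) = sqrt n * L (?Q - P)"
        by (simp add: A sum_distrib_left mult.left_commute)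
      ultimately show ?thesis by (simp add: right_diff_distrib)
    qed
    moreover have "\<bar>\<Sum>i\<in>UNIV. \<Sum>j\<in>UNIV. \<bar>sqrt n * ?e n \<omega> i j\<bar>\<bar> = sqrt n * ?D"
    proof -
      have "(\<Sum>i\<in>UNIV. \<Sum>j\<in>UNIV. \<bar>sqrt n * ?e n \<omega> i j\<bar>) = sqrt n * ?D"
        by (simp add: abs_mult sum_distrib_left)
      moreover have "0 \<le> ?D" by (intro sum_nonneg) simp
      ultimately show ?thesis by (simp only: abs_of_nonneg mult_nonneg_nonneg real_sqrt_ge_zero of_nat_0_le_iff)
    qed
    ultimately show ?thesis by (simp only: abs_mult) (simp add: mult.left_commute)
  qed
  show "\<exists>\<delta>>0. \<forall>n. \<forall>\<omega>\<in>space M. \<bar>\<Sum>i\<in>UNIV. \<Sum>j\<in>UNIV. \<bar>?e n \<omega> i j\<bar>\<bar> < \<delta> \<longrightarrow>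
      \<bar>sqrt n * (Z n \<omega> - f P) - (\<Sum>i\<in>UNIV. \<Sum>j\<in>UNIV. A $ i $ j * (sqrt n * ?e n \<omega> i j))\<bar>
      \<le> \<epsilon> * \<bar>\<Sum>i\<in>UNIV. \<Sum>j\<in>UNIV. \<bar>sqrt n * ?e n \<omega> i j\<bar>\<bar>"
    using bound \<delta>1(1) \<delta>2(1) by (intro exI[of _ "min \<delta>1 \<delta>2"]) simp
qed

text \<open>To first order, a linear functional \<open>A\<close> of the scaled estimation error is the centred
  additive functional of the function \<open>g\<close> in the proof, whose asymptotic variance is the
  variance of \<open>A\<close> applied to the Gaussian matrix.\<close>

theorem delta_method:
  fixes W :: "'b \<Rightarrow> real^'s^'s"
  assumes f: "(f has_derivative L) (at P within irreducibles)" and Z: "plug_in M X f Z"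
    and W: "limit_matrix N W P"
  shows "converges_in_dist M (\<lambda>n \<omega>. sqrt n * (Z n \<omega> - f P)) N (\<lambda>\<omega>. L (W \<omega>))"
proof -
  let ?\<pi> = "stationary P"
  obtain A :: "real^'s^'s" where A: "\<And>H. L H = (\<Sum>i\<in>UNIV. \<Sum>j\<in>UNIV. A $ i $ j * H $ i $ j)"
    using linear_matrix_functional[OF has_derivative_linear[OF f]] by blast
  define m where "m = (\<lambda>i. \<Sum>j\<in>UNIV. P $ i $ j * A $ i $ j)"
  define g where "g = (\<lambda>i j. (A $ i $ j - m i) / ?\<pi> $ i)"
  have m: "m i = (\<Sum>j\<in>UNIV. P $ i $ j * A $ i $ j)" for i by (simp add: m_def)
  have g_centred: "(\<Sum>j\<in>UNIV. P $ i $ j * g i j) = 0" for i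
  proof -
    have "(\<Sum>j\<in>UNIV. P $ i $ j * g i j) = (m i - (\<Sum>j\<in>UNIV. P $ i $ j) * m i) / ?\<pi> $ i"
      unfolding m_def g_def times_divide_eq_right sum_divide_distrib[symmetric] right_diff_distrib
        sum_subtractf sum_distrib_right ..
    then show ?thesis by (simp add: P_row_sum)
  qed
  have g_eq: "(\<Sum>i\<in>UNIV. \<Sum>j\<in>UNIV. A $ i $ j * deviation i j a b / ?\<pi> $ i) = g a b" for a b
  proof -
    have "(\<Sum>i\<in>UNIV. \<Sum>j\<in>UNIV. A $ i $ j * deviation i j a b / ?\<pi> $ i)
        = (\<Sum>i\<in>UNIV. if i = a then (\<Sum>j\<in>UNIV. A $ a $ j * (of_bool (b = j) - P $ a $ j)) / ?\<pi> $ a else 0)"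
      by (intro sum.cong refl) (auto simp: deviation_def sum_divide_distrib)
    also have "\<dots> = (\<Sum>j\<in>UNIV. A $ a $ j * (of_bool (b = j) - P $ a $ j)) / ?\<pi> $ a" by simp
    also have "(\<Sum>j\<in>UNIV. A $ a $ j * (of_bool (b = j) - P $ a $ j)) = A $ a $ b - m a"
      by (simp add: right_diff_distrib sum_subtractf m_def of_bool_def mult.commute
          if_distrib[of "\<lambda>x. _ * x"] cong: if_cong)
    finally show ?thesis by (simp add: g_def)
  qed
  have lin: "(\<Sum>i\<in>UNIV. \<Sum>j\<in>UNIV. A $ i $ j * (additive_sum (deviation i j) n \<omega> / sqrt n / ?\<pi> $ i))
      = additive_sum g n \<omega> / sqrt n" for n \<omega>
  proof -
    have "additive_sum g n \<omega> = (\<Sum>k<n. \<Sum>i\<in>UNIV. \<Sum>j\<in>UNIV.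
        A $ i $ j * deviation i j (X k \<omega>) (X (Suc k) \<omega>) / ?\<pi> $ i)"
      by (simp only: additive_sum_def g_eq)
    also have "\<dots> = (\<Sum>i\<in>UNIV. \<Sum>k<n. \<Sum>j\<in>UNIV.
        A $ i $ j * deviation i j (X k \<omega>) (X (Suc k) \<omega>) / ?\<pi> $ i)"
      by (rule sum.swap)
    also have "\<dots> = (\<Sum>i\<in>UNIV. \<Sum>j\<in>UNIV. \<Sum>k<n.
        A $ i $ j * deviation i j (X k \<omega>) (X (Suc k) \<omega>) / ?\<pi> $ i)"
      by (intro sum.cong refl sum.swap)
    also have "\<dots> = (\<Sum>i\<in>UNIV. \<Sum>j\<in>UNIV. A $ i $ j * additive_sum (deviation i j) n \<omega> / ?\<pi> $ i)"
      by (simp only: additive_sum_def sum_distrib_left sum_divide_distrib)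
    finally show ?thesis by (simp add: sum_divide_distrib mult_ac)
  qed
  define \<sigma>2 where "\<sigma>2 = (\<Sum>i\<in>UNIV. ?\<pi> $ i * (\<Sum>j\<in>UNIV. P $ i $ j * (g i j)\<^sup>2))"
  have \<sigma>2: "\<sigma>2 = (\<Sum>i\<in>UNIV. ((\<Sum>j\<in>UNIV. P $ i $ j * (A $ i $ j)\<^sup>2)
      - (\<Sum>j\<in>UNIV. P $ i $ j * A $ i $ j)\<^sup>2) / ?\<pi> $ i)"
    unfolding \<sigma>2_def
  proof (intro sum.cong refl)
    fix i
    have "(\<Sum>j\<in>UNIV. P $ i $ j * (A $ i $ j - m i)\<^sup>2)
        = (\<Sum>j\<in>UNIV. P $ i $ j * (A $ i $ j)\<^sup>2 - 2 * m i * (P $ i $ j * A $ i $ j) + (m i)\<^sup>2 * P $ i $ j)"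
      by (intro sum.cong refl) (simp add: power2_diff algebra_simps)
    also have "\<dots> = (\<Sum>j\<in>UNIV. P $ i $ j * (A $ i $ j)\<^sup>2) - 2 * m i * m i + (m i)\<^sup>2"
      unfolding sum.distrib sum_subtractf sum_distrib_left[symmetric] P_row_sum m[symmetric] by simp
    finally have var: "(\<Sum>j\<in>UNIV. P $ i $ j * (A $ i $ j - m i)\<^sup>2)
        = (\<Sum>j\<in>UNIV. P $ i $ j * (A $ i $ j)\<^sup>2) - (m i)\<^sup>2" by (simp add: power2_eq_square)
    have "?\<pi> $ i * (\<Sum>j\<in>UNIV. P $ i $ j * (g i j)\<^sup>2)
        = ?\<pi> $ i * ((\<Sum>j\<in>UNIV. P $ i $ j * (A $ i $ j - m i)\<^sup>2) / (?\<pi> $ i)\<^sup>2)"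
      by (simp add: g_def power_divide sum_divide_distrib)
    also have "\<dots> = (\<Sum>j\<in>UNIV. P $ i $ j * (A $ i $ j - m i)\<^sup>2) / ?\<pi> $ i"
      using stationary_positive[of i] by (simp add: power2_eq_square)
    finally show "?\<pi> $ i * (\<Sum>j\<in>UNIV. P $ i $ j * (g i j)\<^sup>2)
        = ((\<Sum>j\<in>UNIV. P $ i $ j * (A $ i $ j)\<^sup>2) - (\<Sum>j\<in>UNIV. P $ i $ j * A $ i $ j)\<^sup>2) / ?\<pi> $ i"
      by (simp only: var m[symmetric])
  qed
  have law: "distr N borel (\<lambda>\<omega>. L (W \<omega>)) = normal_law 0 \<sigma>2" "0 \<le> \<sigma>2"
    unfolding A \<sigma>2 using limit_matrix_linear_functional[OF W, of A] by blast+
  have Wm: "prob_space N" "W \<in> borel_measurable N"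
    using W by (auto simp: limit_matrix_def gaussian_matrix_def)
  have Zm [measurable]: "random_variable borel (Z n)" for n using Z by (simp add: plug_in_def)
  show ?thesis
  proof (rule converges_in_dist_via_char[where T = "\<lambda>n \<omega>. additive_sum g n \<omega> / sqrt n"])
    show "random_variable borel (\<lambda>\<omega>. sqrt n * (Z n \<omega> - f P))" for n by measurable
    show "random_variable borel (\<lambda>\<omega>. additive_sum g n \<omega> / sqrt n)" for n by measurable
    have "vanishes_in_prob (\<lambda>n \<omega>. (sqrt n * (Z n \<omega> - f P)
        - (\<Sum>i\<in>UNIV. \<Sum>j\<in>UNIV. A $ i $ j * (sqrt n * (P_hat X n \<omega> $ i $ j - P $ i $ j))))
      + (\<Sum>i\<in>UNIV. \<Sum>j\<in>UNIV. A $ i $ j * (sqrt n * (P_hat X n \<omega> $ i $ j - P $ i $ j)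
        - additive_sum (deviation i j) n \<omega> / sqrt n / ?\<pi> $ i)))"
      by (intro vanishes_in_prob_add plug_in_linearization[OF f Z A] vanishes_in_prob_sum
          vanishes_in_prob_cmult P_hat_linearization finite)
    then show "vanishes_in_prob (\<lambda>n \<omega>. sqrt n * (Z n \<omega> - f P) - additive_sum g n \<omega> / sqrt n)"
      unfolding right_diff_distrib[of "A $ _ $ _"] sum_subtractf lin by simp
    show "prob_space N" by (rule Wm)
    have "continuous_on UNIV L"
      by (rule linear_continuous_on[OF has_derivative_bounded_linear[OF f]])
    then show "(\<lambda>\<omega>. L (W \<omega>)) \<in> borel_measurable N"
      by (intro measurable_compose[OF Wm(2)] borel_measurable_continuous_onI)
    show "(\<lambda>n. char (distr M borel (\<lambda>\<omega>. additive_sum g n \<omega> / sqrt n)) t)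
        \<longlonglongrightarrow> char (distr N borel (\<lambda>\<omega>. L (W \<omega>))) t" for t
      using additive_char_limit[OF g_centred, of t] char_normal_law[OF law(2), of t]
      by (simp only: law(1) \<sigma>2_def)
  qed
qed

end

theorem proposition8:
  fixes M :: "'a measure" and X :: "nat \<Rightarrow> 'a \<Rightarrow> 's::finite" and P :: "real^'s^'s"
    and N :: "'b measure" and W :: "'b \<Rightarrow> real^'s^'s"
  assumes "irreducible_stochastic P"
    and "markov_chain M X P"
    and "limit_matrix N W P"
  shows
    "(\<forall>g :: real^'s.
        (\<forall>H\<in>tangent_space P.
           ((\<lambda>t. phi g (P + t *\<^sub>R H)) has_real_derivative phi_deriv g P H) (at 0)) \<and>
        (\<forall>Z. plug_in M X (phi g) Z \<longrightarrow>
           converges_in_dist M (\<lambda>n \<omega>. sqrt (real n) * (Z n \<omega> - phi g P))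
             N (\<lambda>\<omega>. phi_deriv g P (W \<omega>)))) \<and>
     (\<forall>Z. plug_in M X kemeny Z \<longrightarrow>
        converges_in_dist M (\<lambda>n \<omega>. sqrt (real n) * (Z n \<omega> - kemeny P))
          N (\<lambda>\<omega>. trace (R_stat P ** W \<omega> ** R_stat P))) \<and>
     ((\<forall>i j. 0 < P $ i $ j) \<longrightarrow>
        (\<forall>Z. plug_in M X entropy_rate Z \<longrightarrow>
           converges_in_dist M (\<lambda>n \<omega>. sqrt (real n) * (Z n \<omega> - entropy_rate P))
             N (\<lambda>\<omega>. (stationary P v* (W \<omega> ** R_stat P)) \<bullet> row_entropy P
                    - (\<Sum>i\<in>UNIV. stationary P $ i * (\<Sum>j\<in>UNIV. W \<omega> $ i $ j * ln (P $ i $ j))))))"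
proof -
  interpret prob_space M using assms(2) by (simp add: markov_chain_def)
  interpret irreducible_chain M X P using assms(1,2) by unfold_locales
  show ?thesis
    using directional_derivative[OF irr phi_has_derivative[OF irr]]
      delta_method[OF phi_has_derivative[OF irr] _ assms(3)]
      delta_method[OF kemeny_has_derivative[OF irr] _ assms(3)]
      delta_method[OF entropy_rate_has_derivative[OF irr] _ assms(3)]
    by blast
qed

end
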